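(* There is an algorithm which, for every $n$, every $f:\{0,1\}^n\to\{0,1\}$ with $f^{-1}(1)\neq\emptyset$, every distance parameter $\varepsilon\in(0,1)$ and every error parameter $\delta\in(0,1)$, is given oracle access to $\mathrm{MQ}(f)$ and $\mathrm{SAMP}(f)$ together with $\varepsilon$ and $\delta$ (but not the value $N=|f^{-1}(1)|$), and satisfies: with probability at least $1-\delta$ it makes no more than $\tilde{O}\big(\frac{\log N}{\varepsilon}+\log(1/\delta)\big)$ calls in total to $\mathrm{MQ}(f)$ and $\mathrm{SAMP}(f)$; if $f$ is unate it always accepts; if $\mathrm{reldist}(f,\mathsf{Unate})>\varepsilon$ it rejects with probability at least $2/3$.
   Context: Relative-error testing model: for an unknown $f:\{0,1\}^n\to\{0,1\}$, the membership oracle $\mathrm{MQ}(f)$ returns $f(x)$ on query $x\in\{0,1\}^n$, and each call to the sampling oracle $\mathrm{SAMP}(f)$ returns an independent uniformly random element of $f^{-1}(1)$. A function $f$ is unate if for every coordinate $i\in[n]$, either $f(x^{i\leftarrow 0})\le f(x^{i\leftarrow 1})$ for all $x$, or $f(x^{i\leftarrow 0})\ge f(x^{i\leftarrow 1})$ for all $x$ (here $x^{i\leftarrow b}$ is $x$ with its $i$-th bit set to $b$); $\mathsf{Unate}$ is the class of unate functions. $\mathrm{reldist}(f,g)=|f^{-1}(1)\,\triangle\, g^{-1}(1)|/|f^{-1}(1)|$ and $\mathrm{reldist}(f,\mathsf{Unate})=\min_{g\in\mathsf{Unate}}\mathrm{reldist}(f,g)$. Logarithms are base 2; $\tilde{O}(\cdot)$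 hides polylogarithmic factors. *)

theory Defs
  imports "HOL-Probability.Probability"
begin

definition cube :: "nat \<Rightarrow> bool list set" where
  "cube n = {x. length x = n}"

text \<open>A Boolean function on the \<open>n\<close>-cube is represented by any \<open>f :: bool list \<Rightarrow> bool\<close>; every notion
  below depends only on the restriction of \<open>f\<close> to \<^term>\<open>cube n\<close>. The set \<open>ones n f\<close> is
  the preimage of 1.\<close>

definition ones :: "nat \<Rightarrow> (bool list \<Rightarrow> bool) \<Rightarrow> bool list set" where
  "ones n f = {x \<in> cube n. f x}"

definition unate :: "nat \<Rightarrow> (bool list \<Rightarrow> bool) \<Rightarrow> bool" where
  "unate n f \<longleftrightarrow> (\<forall>i<n.
     (\<forall>x\<in>cube n. f (x[i := False]) \<le> f (x[i := True])) \<or>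
     (\<forall>x\<in>cube n. f (x[i := False]) \<ge> f (x[i := True])))"

definition reldist :: "nat \<Rightarrow> (bool list \<Rightarrow> bool) \<Rightarrow> (bool list \<Rightarrow> bool) \<Rightarrow> real" where
  "reldist n f g =
     real (card ((ones n f - ones n g) \<union> (ones n g - ones n f))) / real (card (ones n f))"

definition reldist_unate :: "nat \<Rightarrow> (bool list \<Rightarrow> bool) \<Rightarrow> real" where
  "reldist_unate n f = Min (reldist n f ` {g. unate n g})"

lemma finite_cube: "finite (cube n)"
  using finite_lists_length_eq[of "UNIV :: bool set" n] by (simp add: cube_def)

lemma finite_ones: "finite (ones n f)"
  by (simp add: ones_def finite_cube)

text \<open>The minimum defining \<^const>\<open>reldist_unate\<close> is over a finite nonempty set.\<close>

lemma finite_reldist_image: "finite (reldist n f ` G)"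
proof (rule finite_subset)
  let ?h = "\<lambda>B. real (card ((ones n f - B) \<union> (B - ones n f))) / real (card (ones n f))"
  show "reldist n f ` G \<subseteq> ?h ` Pow (cube n)"
    by (auto simp: reldist_def ones_def)
  show "finite (?h ` Pow (cube n))"
    by (simp add: finite_cube)
qed

lemma unate_nonempty: "{g. unate n g} \<noteq> {}"
  by (auto simp: unate_def intro!: exI[of _ "\<lambda>_. False"])

text \<open>A randomized adaptive oracle algorithm in the query model, as a strategy tree: it halts
  with a verdict (\<open>True\<close> = accept), calls the membership oracle on a point, calls the sampling
  oracle, or draws internal randomness from a discrete distribution. Only oracle calls are
  counted. The tree may be of unbounded depth, but each of its runs is finite.\<close>

datatype tester =
    Halt bool
  | Query "bool list" "bool \<Rightarrow> tester"
  | Sample "bool list \<Rightarrow> tester"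
  | Draw "nat pmf" "nat \<Rightarrow> tester"

definition MQ :: "nat \<Rightarrow> (bool list \<Rightarrow> bool) \<Rightarrow> bool list \<Rightarrow> bool" where
  "MQ n f x \<longleftrightarrow> x \<in> ones n f"

text \<open>Meaningful only if \<^term>\<open>ones n f\<close> is nonempty.\<close>

definition SAMP :: "nat \<Rightarrow> (bool list \<Rightarrow> bool) \<Rightarrow> bool list pmf" where
  "SAMP n f = pmf_of_set (ones n f)"

text \<open>Joint distribution of the verdict and the total number of oracle calls.\<close>

primrec run :: "nat \<Rightarrow> (bool list \<Rightarrow> bool) \<Rightarrow> tester \<Rightarrow> (bool \<times> nat) pmf" where
  "run n f (Halt b) = return_pmf (b, 0)"
| "run n f (Query x k) = map_pmf (apsnd Suc) (run n f (k (MQ n f x)))"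
| "run n f (Sample k) =
     bind_pmf (SAMP n f) (\<lambda>x. map_pmf (apsnd Suc) (run n f (k x)))"
| "run n f (Draw p k) = bind_pmf p (\<lambda>r. run n f (k r))"

text \<open>Soft-O with explicit constants, valid uniformly in all parameters: for \<open>t \<ge> 2\<close> the bound is
  \<open>C t (log t)\<^sup>k\<close>, with the hidden factor polylogarithmic in \<open>t\<close> itself. The truncation
  at 2 turns the bound into a constant where \<open>log t\<close> is small or negative.\<close>

definition soft_O_bound :: "real \<Rightarrow> nat \<Rightarrow> real \<Rightarrow> real" where
  "soft_O_bound C k t = C * max 2 t * log 2 (max 2 t) ^ k"

end

theory Submission
  imports Defs
begin

text \<open>For an orientation of the cube, sorting the coordinates one after the other shows that the
  distance to unate is at most twice the number of wrongly oriented edges. So if \<open>f\<close> is far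
  from unate, many directions have sensitive edges of both orientations.

  Fix one sample \<open>z\<close> and let \<open>d\<close> be the largest number of coordinates in which one of
  \<open>O(1/\<epsilon>)\<close> further samples differs from \<open>z\<close>. A trial takes a sample \<open>x\<close>, a random coordinate
  \<open>i\<close> in which it differs from \<open>z\<close>, and looks for samples sensitive at \<open>i\<close> with both values of
  coordinate \<open>i\<close>, among \<open>M/1, M/2, M/3, \<dots>\<close> fresh samples in successive trials. With
  \<open>M = O(d/\<epsilon>)\<close> this succeeds, because a direction in which at least a quarter of all samples
  differ from \<open>z\<close> is picked with probability \<open>\<Omega>(1/d)\<close>, whereas in any other direction half of all
  samples are sensitive and agree with \<open>z\<close>.

  To bound the cost one needs \<open>d = O(log N)\<close> although \<open>N\<close> is unknown. Let \<open>x\<close> and \<open>z\<close> differ on a set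
  of \<open>2h\<close> coordinates with \<open>h \<ge> 2 log N\<close>. Flipping in \<open>x\<close> a random subset of at least \<open>h\<close> of these
  coordinates gives a zero of \<open>f\<close> with high probability, and then binary search finds a
  sensitive edge. Collecting \<open>h\<close> coordinates in this way and then searching from \<open>z\<close>
  inside the collected set gives two edges of opposite orientation in one direction. This is tried with
  \<open>h = 1, 2, 4, \<dots>\<close> on the farthest sample, so with probability \<open>1 - \<delta>\<close> either \<open>d\<close> is small or
  \<open>f\<close> is rejected. As rejection requires an explicit violation, unate functions are always accepted.\<close>

section \<open>Sorting towards a unate function\<close>

definition flip :: "nat set \<Rightarrow> bool list \<Rightarrow> bool list" where
  "flip A x = map (\<lambda>j. (x ! j) \<noteq> (j \<in> A)) [0..<length x]"

lemma length_flip [simp]: "length (flip A x) = length x"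
  by (simp add: flip_def)

lemma nth_flip [simp]: "j < length x \<Longrightarrow> flip A x ! j = ((x ! j) \<noteq> (j \<in> A))"
  by (simp add: flip_def)

lemma flip_flip: "flip A (flip B x) = flip ((A - B) \<union> (B - A)) x"
  by (rule nth_equalityI) auto

lemma flip_flip_disjoint: "A \<inter> B = {} \<Longrightarrow> flip A (flip B x) = flip (A \<union> B) x"
  by (rule nth_equalityI) auto

lemma flip_empty [simp]: "flip {} x = x"
  by (rule nth_equalityI) auto

lemma flip_twice [simp]: "flip A (flip A x) = x"
  by (simp add: flip_flip)

lemma flip_commute: "flip A (flip B x) = flip B (flip A x)"
  by (rule nth_equalityI) auto

lemma flip_eq_iff: "flip A x = flip A y \<longleftrightarrow> x = y"
  by (metis flip_twice)

lemma inj_flip: "inj (flip A)"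
  by (simp add: inj_def flip_eq_iff)

lemma flip_inj_set:
  assumes "flip A x = flip B x" "A \<subseteq> {..<length x}" "B \<subseteq> {..<length x}"
  shows "A = B"
proof -
  have "j \<in> A \<longleftrightarrow> j \<in> B" if "j < length x" for j
    using arg_cong[OF assms(1), of "\<lambda>w. w ! j"] that by auto
  then show ?thesis using assms by blast
qed

text \<open>The sensitive edges in direction \<open>i\<close> oriented against \<open>a\<close>,
  each counted at its endpoint of value 1, which should have \<open>a i\<close> in coordinate
  \<open>i\<close>.\<close>

definition viol :: "nat \<Rightarrow> (nat \<Rightarrow> bool) \<Rightarrow> (bool list \<Rightarrow> bool) \<Rightarrow> nat \<Rightarrow> bool list set" where
  "viol n a f i = {x \<in> cube n. x ! i \<noteq> a i \<and> f x \<and> \<not> f (flip {i} x)}"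

text \<open>The sorting operator of monotonicity testing: on each edge in direction \<open>i\<close>
  the larger value goes to the end with coordinate \<open>a i\<close>.\<close>

definition sort_dir :: "(nat \<Rightarrow> bool) \<Rightarrow> nat \<Rightarrow> (bool list \<Rightarrow> bool) \<Rightarrow> bool list \<Rightarrow> bool" where
  "sort_dir a i f x =
     (if x ! i = a i then f x \<or> f (flip {i} x) else f x \<and> f (flip {i} x))"

lemma finite_viol: "finite (viol n a f i)"
  by (simp add: viol_def finite_cube)

lemma viol_sort_dir_same: "i < n \<Longrightarrow> viol n a (sort_dir a i f) i = {}"
  by (auto simp: viol_def sort_dir_def cube_def)

text \<open>Sorting swaps the values on wrongly oriented edges and changes nothing else; the 2
  counts both endpoints.\<close>

lemma card_sort_dir_diff:
  assumes "i < n"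
  shows "card {x \<in> cube n. f x \<noteq> sort_dir a i f x} \<le> 2 * card (viol n a f i)"
proof -
  have "{x \<in> cube n. f x \<noteq> sort_dir a i f x} \<subseteq> viol n a f i \<union> flip {i} ` viol n a f i"
  proof
    fix x assume x: "x \<in> {x \<in> cube n. f x \<noteq> sort_dir a i f x}"
    then have l: "length x = n" by (simp add: cube_def)
    show "x \<in> viol n a f i \<union> flip {i} ` viol n a f i"
    proof (cases "x ! i = a i")
      case True
      then have "flip {i} x \<in> viol n a f i"
        using x l assms by (auto simp: viol_def sort_dir_def cube_def)
      then have "flip {i} (flip {i} x) \<in> flip {i} ` viol n a f i" by (rule imageI)
      then show ?thesis by simp
    next
      case False
      then show ?thesis using x by (auto simp: viol_def sort_dir_def)
    qed
  qed
  then have "card {x \<in> cube n. f x \<noteq> sort_dir a i f x}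
      \<le> card (viol n a f i \<union> flip {i} ` viol n a f i)"
    by (intro card_mono) (auto simp: finite_viol)
  also have "\<dots> \<le> card (viol n a f i) + card (flip {i} ` viol n a f i)"
    by (rule card_Un_le)
  also have "\<dots> \<le> 2 * card (viol n a f i)"
    using card_image_le[OF finite_viol, of "flip {i}" n a f i] by simp
  finally show ?thesis .
qed

text \<open>Groups the edges in direction \<open>j\<close> into the squares spanned by
  \<open>i\<close> and \<open>j\<close>, two per square, so that sorting along \<open>i\<close> can
  be checked square by square.\<close>

lemma card_viol_split:
  assumes "i < n" "j < n" "i \<noteq> j"
  shows "card (viol n a f j) = (\<Sum>x \<in> {x \<in> cube n. x ! j \<noteq> a j \<and> x ! i = a i}.
      of_bool (f x \<and> \<not> f (flip {j} x)) +
      of_bool (f (flip {i} x) \<and> \<not> f (flip {i} (flip {j} x))))"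
    (is "_ = sum ?t ?X")
proof -
  let ?Y = "{x \<in> cube n. x ! j \<noteq> a j \<and> x ! i \<noteq> a i}"
  let ?v = "\<lambda>x. of_bool (f x \<and> \<not> f (flip {j} x)) :: nat"
  have fin: "finite ?X" "finite ?Y" by (auto simp: finite_cube)
  have "?Y \<subseteq> flip {i} ` ?X"
  proof
    fix y assume "y \<in> ?Y"
    then have "flip {i} y \<in> ?X" using assms by (auto simp: cube_def)
    then have "flip {i} (flip {i} y) \<in> flip {i} ` ?X" by (rule imageI)
    then show "y \<in> flip {i} ` ?X" by simp
  qed
  moreover have "flip {i} ` ?X \<subseteq> ?Y"
    using assms by (auto simp: cube_def)
  ultimately have img: "?Y = flip {i} ` ?X" by blast
  have Y: "sum ?v ?Y = (\<Sum>x\<in>?X. ?v (flip {i} x))"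
    unfolding img by (rule sum.reindex_cong[OF inj_on_subset[OF inj_flip]]) auto
  have "viol n a f j = {x \<in> ?X \<union> ?Y. f x \<and> \<not> f (flip {j} x)}"
    by (auto simp: viol_def)
  then have "card (viol n a f j) = sum ?v (?X \<union> ?Y)"
    using fin by (simp add: sum.If_cases of_bool_def Int_def)
  also have "\<dots> = sum ?v ?X + sum ?v ?Y"
    using fin by (intro sum.union_disjoint) auto
  also have "\<dots> = sum ?t ?X"
    unfolding Y by (simp add: sum.distrib flip_commute[of "{j}" "{i}"])
  finally show ?thesis .
qed

text \<open>Only the four values on a square matter, and a finite check of these suffices.\<close>

lemma card_viol_sort_dir:
  assumes "i < n" "j < n" "i \<noteq> j"
  shows "card (viol n a (sort_dir a i f) j) \<le> card (viol n a f j)"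
  unfolding card_viol_split[OF assms]
proof (rule sum_mono)
  fix x assume "x \<in> {x \<in> cube n. x ! j \<noteq> a j \<and> x ! i = a i}"
  then have x: "length x = n" "x ! i = a i" by (auto simp: cube_def)
  show "of_bool (sort_dir a i f x \<and> \<not> sort_dir a i f (flip {j} x)) +
      of_bool (sort_dir a i f (flip {i} x) \<and> \<not> sort_dir a i f (flip {i} (flip {j} x)))
      \<le> (of_bool (f x \<and> \<not> f (flip {j} x)) +
      of_bool (f (flip {i} x) \<and> \<not> f (flip {i} (flip {j} x))) :: nat)"
    using x assms by (auto simp: sort_dir_def)
qed

lemma unate_if_no_viol:
  assumes "\<And>i. i < n \<Longrightarrow> viol n a f i = {}"
  shows "unate n f"
  unfolding unate_def
proof (intro allI impI)
  fix i assume i: "i < n"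
  have up: "f (x[i := a i])" if "x \<in> cube n" "f (x[i := \<not> a i])" for x
  proof -
    have "flip {i} (x[i := \<not> a i]) = x[i := a i]"
      using that by (intro nth_equalityI) (auto simp: nth_list_update cube_def)
    moreover have "x[i := \<not> a i] \<notin> viol n a f i"
      using assms[OF i] by simp
    ultimately show ?thesis using that i by (auto simp: viol_def cube_def)
  qed
  show "(\<forall>x\<in>cube n. f (x[i := False]) \<le> f (x[i := True])) \<or>
     (\<forall>x\<in>cube n. f (x[i := False]) \<ge> f (x[i := True]))"
    using up by (cases "a i") auto
qed

text \<open>Directions are sorted one after the other. By \<open>card_viol_sort_dir\<close> a sorted
  direction stays sorted, and sorting direction \<open>m\<close> costs at most twice its original
  count.\<close>

lemma unate_approx:
  "\<exists>g. unate n g \<and> card {x \<in> cube n. f x \<noteq> g x} \<le> 2 * (\<Sum>i<n. card (viol n a f i))"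
proof -
  have "\<exists>g. (\<forall>j<m. viol n a g j = {}) \<and> (\<forall>j<n. card (viol n a g j) \<le> card (viol n a f j)) \<and>
      card {x \<in> cube n. f x \<noteq> g x} \<le> 2 * (\<Sum>i<m. card (viol n a f i))" if "m \<le> n" for m
    using that
  proof (induction m)
    case 0
    show ?case by (rule exI[of _ f]) auto
  next
    case (Suc m)
    then obtain g where g: "\<And>j. j < m \<Longrightarrow> viol n a g j = {}"
      "\<And>j. j < n \<Longrightarrow> card (viol n a g j) \<le> card (viol n a f j)"
      "card {x \<in> cube n. f x \<noteq> g x} \<le> 2 * (\<Sum>i<m. card (viol n a f i))"
      by auto
    let ?h = "sort_dir a m g"
    have m: "m < n" using Suc by simp
    have le: "card (viol n a ?h j) \<le> card (viol n a g j)" if "j < n" for j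
      using card_viol_sort_dir[OF m that] viol_sort_dir_same[OF m]
      by (cases "j = m") auto
    have "viol n a ?h j = {}" if "j < Suc m" for j
    proof (cases "j = m")
      case True
      then show ?thesis using viol_sort_dir_same[OF m] by simp
    next
      case False
      then have "card (viol n a ?h j) \<le> 0" using le[of j] g(1)[of j] that m by simp
      then show ?thesis using finite_viol by auto
    qed
    moreover have "card (viol n a ?h j) \<le> card (viol n a f j)" if "j < n" for j
      using le[OF that] g(2)[OF that] by simp
    moreover have "card {x \<in> cube n. f x \<noteq> ?h x} \<le> 2 * (\<Sum>i<Suc m. card (viol n a f i))"
    proof -
      have "card {x \<in> cube n. f x \<noteq> ?h x}
          \<le> card ({x \<in> cube n. f x \<noteq> g x} \<union> {x \<in> cube n. g x \<noteq> ?h x})"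
        by (intro card_mono) (auto simp: finite_cube)
      also have "\<dots> \<le> card {x \<in> cube n. f x \<noteq> g x} + card {x \<in> cube n. g x \<noteq> ?h x}"
        by (rule card_Un_le)
      also have "\<dots> \<le> 2 * (\<Sum>i<m. card (viol n a f i)) + 2 * card (viol n a f m)"
        using g(3) card_sort_dir_diff[OF m, of g a] g(2)[OF m] by linarith
      finally show ?thesis by simp
    qed
    ultimately show ?case by blast
  qed
  from this[of n] obtain g where "\<forall>j<n. viol n a g j = {}"
    "card {x \<in> cube n. f x \<noteq> g x} \<le> 2 * (\<Sum>i<n. card (viol n a f i))" by auto
  then show ?thesis using unate_if_no_viol[of n a g] by blast
qed

section \<open>Sensitive edges forced by distance from unate\<close>

definition sens :: "nat \<Rightarrow> (bool list \<Rightarrow> bool) \<Rightarrow> nat \<Rightarrow> bool \<Rightarrow> bool list set" where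
  "sens n f i c = {x \<in> ones n f. x ! i = c \<and> flip {i} x \<notin> ones n f}"

lemma finite_sens: "finite (sens n f i c)"
  by (simp add: sens_def finite_ones)

definition diff :: "bool list \<Rightarrow> bool list \<Rightarrow> nat list" where
  "diff x z = filter (\<lambda>i. x ! i \<noteq> z ! i) [0..<length x]"

text \<open>The points of \<open>H\<close> are deleted first. Outside \<open>T\<close> the orientation is that of \<open>z\<close>, so
  every edge made sensitive by the deletion is oriented correctly, and no edge in a direction
  of \<open>T\<close> becomes sensitive.\<close>

lemma far_from_unate:
  fixes T :: "nat set" and d :: nat
  assumes far: "reldist_unate n f > \<epsilon>" and ne: "ones n f \<noteq> {}"
    and T: "T \<subseteq> {..<n}" and z: "length z = n"
  defines "H \<equiv> {x \<in> ones n f. card (set (diff x z) - T) > d}"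
  shows "\<epsilon> * card (ones n f) < real (card H + 2 *
    ((\<Sum>i\<in>T. min (card (sens n f i True)) (card (sens n f i False))) +
     (\<Sum>i\<in>{..<n} - T. card (sens n f i (\<not> z ! i) - H))))"
proof -
  let ?N = "card (ones n f)"
  \<comment> \<open>On \<open>T\<close> the more frequent orientation is kept, so the wrong edges
    number the minimum of the two counts.\<close>
  define a where "a i = (if i \<in> T then card (sens n f i False) \<le> card (sens n f i True) else z ! i)"
    for i
  define g where "g x \<longleftrightarrow> f x \<and> x \<notin> H" for x
  have N: "?N > 0" using ne by (simp add: finite_ones card_gt_0_iff)
  obtain h where h: "unate n h" "card {x \<in> cube n. g x \<noteq> h x} \<le> 2 * (\<Sum>i<n. card (viol n a g i))"
    using unate_approx[of n g a] by blast
  have Hf: "finite H" by (simp add: H_def finite_ones)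
  have sd: "set (diff (flip {i} x) z) = (if x ! i = z ! i then insert i (set (diff x z)) else set (diff x z) - {i})"
    if "i < n" "length x = n" for i x
    using that by (auto simp: diff_def split: if_splits)
  have violT: "viol n a g i \<subseteq> sens n f i (\<not> a i)" if i: "i \<in> T" for i
  proof
    fix x assume x: "x \<in> viol n a g i"
    then have lx: "length x = n" by (simp add: viol_def cube_def)
    have iN: "i < n" using i T by auto
    \<comment> \<open>Membership in \<open>H\<close> ignores coordinates of \<open>T\<close>, so the
      neighbour was not deleted: it is a zero of \<open>f\<close> itself.\<close>
    have "set (diff (flip {i} x) z) - T = set (diff x z) - T"
      using sd[OF iN lx] i by auto
    then have "flip {i} x \<notin> ones n f"
      using x by (auto simp: viol_def g_def H_def ones_def)
    then show "x \<in> sens n f i (\<not> a i)"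
      using x by (auto simp: viol_def sens_def ones_def g_def)
  qed
  have violN: "viol n a g i \<subseteq> sens n f i (\<not> z ! i) - H" if i: "i \<in> {..<n} - T" for i
  proof
    fix x assume x: "x \<in> viol n a g i"
    then have lx: "length x = n" by (simp add: viol_def cube_def)
    have xi: "x ! i \<noteq> z ! i" using x i by (simp add: viol_def a_def)
    \<comment> \<open>The flip moves \<open>x\<close> towards \<open>z\<close>, so it cannot lead
      into \<open>H\<close>.\<close>
    have "set (diff (flip {i} x) z) - T \<subseteq> set (diff x z) - T"
      using sd[OF _ lx, of i] i xi by auto
    then have "card (set (diff (flip {i} x) z) - T) \<le> card (set (diff x z) - T)"
      by (intro card_mono) auto
    then have "flip {i} x \<notin> ones n f"
      using x by (auto simp: viol_def g_def H_def ones_def)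
    then show "x \<in> sens n f i (\<not> z ! i) - H"
      using x xi by (auto simp: viol_def sens_def ones_def g_def)
  qed
  have "(\<Sum>i<n. card (viol n a g i)) =
      (\<Sum>i\<in>T. card (viol n a g i)) + (\<Sum>i\<in>{..<n} - T. card (viol n a g i))"
    using T by (metis add.commute finite_lessThan sum.subset_diff)
  also have "\<dots> \<le> (\<Sum>i\<in>T. min (card (sens n f i True)) (card (sens n f i False))) +
     (\<Sum>i\<in>{..<n} - T. card (sens n f i (\<not> z ! i) - H))"
  proof (intro add_mono sum_mono)
    fix i assume i: "i \<in> T"
    have "card (viol n a g i) \<le> card (sens n f i (\<not> a i))"
      by (intro card_mono violT i finite_sens)
    also have "\<dots> = min (card (sens n f i True)) (card (sens n f i False))"
      using i by (cases "a i") (auto simp: a_def)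
    finally show "card (viol n a g i) \<le> \<dots>" .
  next
    fix i assume i: "i \<in> {..<n} - T"
    show "card (viol n a g i) \<le> card (sens n f i (\<not> z ! i) - H)"
      by (intro card_mono violN i finite_Diff finite_sens)
  qed
  finally have V: "(\<Sum>i<n. card (viol n a g i)) \<le> \<dots>" .
  have "reldist_unate n f \<le> reldist n f h"
    unfolding reldist_unate_def using h(1) finite_reldist_image by (intro Min_le) auto
  then have "\<epsilon> < card ((ones n f - ones n h) \<union> (ones n h - ones n f)) / ?N"
    using far by (simp add: reldist_def)
  then have "\<epsilon> * ?N < card ((ones n f - ones n h) \<union> (ones n h - ones n f))"
    using N by (simp add: field_simps)
  moreover have "card ((ones n f - ones n h) \<union> (ones n h - ones n f))
      \<le> card (H \<union> {x \<in> cube n. g x \<noteq> h x})"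
    by (intro card_mono) (auto simp: finite_cube Hf ones_def g_def)
  moreover have "\<dots> \<le> card H + card {x \<in> cube n. g x \<noteq> h x}"
    by (rule card_Un_le)
  ultimately have lt: "\<epsilon> * ?N < card ((ones n f - ones n h) \<union> (ones n h - ones n f))"
    and le: "card ((ones n f - ones n h) \<union> (ones n h - ones n f))
      \<le> card H + card {x \<in> cube n. g x \<noteq> h x}"
    by simp_all
  note le
  also have "card H + card {x \<in> cube n. g x \<noteq> h x} \<le> card H + 2 *
    ((\<Sum>i\<in>T. min (card (sens n f i True)) (card (sens n f i False))) +
     (\<Sum>i\<in>{..<n} - T. card (sens n f i (\<not> z ! i) - H)))"
    by (intro add_left_mono order_trans[OF h(2)] mult_left_mono V) simp
  finally have "real (card ((ones n f - ones n h) \<union> (ones n h - ones n f))) \<le> real (card H + 2 *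
    ((\<Sum>i\<in>T. min (card (sens n f i True)) (card (sens n f i False))) +
     (\<Sum>i\<in>{..<n} - T. card (sens n f i (\<not> z ! i) - H))))"
    by (rule of_nat_mono)
  then show ?thesis by (rule less_le_trans[OF lt])
qed

section \<open>Cost and acceptance of strategy trees\<close>

abbreviation pr :: "nat \<Rightarrow> (bool list \<Rightarrow> bool) \<Rightarrow> tester \<Rightarrow> (bool \<times> nat) set \<Rightarrow> real" where
  "pr n f T E \<equiv> measure_pmf.prob (run n f T) E"

text \<open>Only exceeding the budget is bad: a run stopped early by a rejection counts as
  good.\<close>

definition bad :: "nat \<Rightarrow> (bool list \<Rightarrow> bool) \<Rightarrow> tester \<Rightarrow> nat \<Rightarrow> real" where
  "bad n f T B = pr n f T {r. B < snd r}"

definition acc :: "nat \<Rightarrow> (bool list \<Rightarrow> bool) \<Rightarrow> tester \<Rightarrow> real" where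
  "acc n f T = pr n f T {r. fst r}"

lemma measure_bind_pmf:
  "measure_pmf.prob (bind_pmf p g) E = measure_pmf.expectation p (\<lambda>x. measure_pmf.prob (g x) E)"
  unfolding measure_pmf_bind
  by (rule measure_pmf.measure_bind[where N = "count_space UNIV"])
    (auto simp: space_subprob_algebra intro: measure_pmf.subprob_space_axioms)

lemma measure_bind_pmf_le:
  assumes "\<And>x. x \<in> set_pmf p \<Longrightarrow> measure_pmf.prob (g x) E \<le> c"
  shows "measure_pmf.prob (bind_pmf p g) E \<le> c"
  unfolding measure_bind_pmf
  by (rule measure_pmf.integral_le_const)
    (auto simp: AE_measure_pmf_iff assms intro!: measure_pmf.integrable_const_bound[where B = 1])

lemma measure_bind_pmf_of_set:
  assumes "finite S" "S \<noteq> {}"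
  shows "measure_pmf.prob (bind_pmf (pmf_of_set S) g) E = (\<Sum>x\<in>S. measure_pmf.prob (g x) E) / card S"
  unfolding measure_bind_pmf using assms by (simp add: integral_pmf_of_set)

lemma bad_nonneg: "0 \<le> bad n f T B" and bad_le_1: "bad n f T B \<le> 1"
  by (simp_all add: bad_def)

lemma bad_antimono: "B \<le> B' \<Longrightarrow> bad n f T B' \<le> bad n f T B"
  unfolding bad_def by (rule measure_pmf.finite_measure_mono) auto

lemma acc_nonneg: "0 \<le> acc n f T" and acc_le_1: "acc n f T \<le> 1"
  by (simp_all add: acc_def)

lemma bad_Halt [simp]: "bad n f (Halt b) B = 0"
  by (simp add: bad_def)

lemma bad_Query [simp]: "bad n f (Query x k) (Suc B) = bad n f (k (MQ n f x)) B"
  by (simp add: bad_def vimage_def)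

lemma acc_Halt [simp]: "acc n f (Halt b) = of_bool b"
  by (simp add: acc_def)

lemma acc_Query [simp]: "acc n f (Query x k) = acc n f (k (MQ n f x))"
  by (simp add: acc_def vimage_def)

lemma acc_Draw_le: "(\<And>r. r \<in> set_pmf p \<Longrightarrow> acc n f (k r) \<le> c) \<Longrightarrow> acc n f (Draw p k) \<le> c"
  by (simp add: acc_def measure_bind_pmf_le)

lemma bad_Draw_le: "(\<And>r. r \<in> set_pmf p \<Longrightarrow> bad n f (k r) B \<le> c) \<Longrightarrow> bad n f (Draw p k) B \<le> c"
  by (simp add: bad_def measure_bind_pmf_le)

lemma acc_Draw_uniform:
  "finite S \<Longrightarrow> S \<noteq> {} \<Longrightarrow> acc n f (Draw (pmf_of_set S) k) = (\<Sum>r\<in>S. acc n f (k r)) / card S"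
  by (simp add: acc_def measure_bind_pmf_of_set)

text \<open>\<open>Draw\<close> yields naturals only, so other countable types are encoded by
  \<open>to_nat\<close>.\<close>

definition draw :: "'a::countable pmf \<Rightarrow> ('a \<Rightarrow> tester) \<Rightarrow> tester" where
  "draw p k = Draw (map_pmf to_nat p) (\<lambda>r. k (from_nat r))"

lemma bad_draw_uniform:
  "finite S \<Longrightarrow> S \<noteq> {} \<Longrightarrow> bad n f (draw (pmf_of_set S) k) B = (\<Sum>r\<in>S. bad n f (k r) B) / card S"
  by (simp add: bad_def draw_def bind_map_pmf measure_bind_pmf_of_set)

definition safe :: "nat \<Rightarrow> (bool list \<Rightarrow> bool) \<Rightarrow> tester \<Rightarrow> bool" where
  "safe n f T \<longleftrightarrow> (\<forall>r\<in>set_pmf (run n f T). fst r)"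

lemma safe_Halt [simp]: "safe n f (Halt b) \<longleftrightarrow> b"
  by (simp add: safe_def)

lemma safe_Query [simp]: "safe n f (Query x k) \<longleftrightarrow> safe n f (k (MQ n f x))"
  by (auto simp: safe_def)

context
  fixes n :: nat and f :: "bool list \<Rightarrow> bool"
  assumes ne: "ones n f \<noteq> {}"
begin

lemma set_SAMP: "set_pmf (SAMP n f) = ones n f"
  by (simp add: SAMP_def ne finite_ones)

lemma acc_Sample: "acc n f (Sample k) = (\<Sum>x\<in>ones n f. acc n f (k x)) / card (ones n f)"
  by (simp add: acc_def SAMP_def measure_bind_pmf_of_set ne finite_ones vimage_def)

lemma acc_Sample_le: "(\<And>x. x \<in> ones n f \<Longrightarrow> acc n f (k x) \<le> c) \<Longrightarrow> acc n f (Sample k) \<le> c"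
  by (auto simp: acc_def set_SAMP vimage_def intro!: measure_bind_pmf_le)

lemma bad_Sample_le:
  "(\<And>x. x \<in> ones n f \<Longrightarrow> bad n f (k x) B \<le> c) \<Longrightarrow> bad n f (Sample k) (Suc B) \<le> c"
  by (auto simp: bad_def set_SAMP vimage_def intro!: measure_bind_pmf_le)

lemma safe_Sample: "(\<And>x. x \<in> ones n f \<Longrightarrow> safe n f (k x)) \<Longrightarrow> safe n f (Sample k)"
  by (auto simp: safe_def set_SAMP)

end

text \<open>\<open>reach n f k c T\<close>: every run of \<open>T\<close> on \<open>f\<close> makes at most \<open>c\<close> calls and then
  either continues with \<open>k\<close> or rejects, the latter only if \<open>f\<close> is not unate.\<close>

inductive reach :: "nat \<Rightarrow> (bool list \<Rightarrow> bool) \<Rightarrow> tester \<Rightarrow> nat \<Rightarrow> tester \<Rightarrow> bool"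
  for n f k where
  refl: "reach n f k c k"
| reject: "\<not> unate n f \<Longrightarrow> reach n f k c (Halt False)"
| query: "reach n f k c (K (MQ n f x)) \<Longrightarrow> reach n f k (Suc c) (Query x K)"
| sample: "(\<And>x. x \<in> ones n f \<Longrightarrow> reach n f k c (K x)) \<Longrightarrow> reach n f k (Suc c) (Sample K)"
| draw: "(\<And>r. r \<in> set_pmf p \<Longrightarrow> reach n f k c (K r)) \<Longrightarrow> reach n f k c (Draw p K)"

lemma reach_mono: "reach n f k c T \<Longrightarrow> c \<le> d \<Longrightarrow> reach n f k d T"
proof (induction arbitrary: d rule: reach.induct)
  case (query c K x)
  then show ?case by (cases d) (auto intro: reach.query)
next
  case (sample c K)
  then show ?case by (cases d) (auto intro: reach.sample)
qed (auto intro: reach.intros)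

lemma reach_trans:
  "reach n f k c T \<Longrightarrow> reach n f k' c' k \<Longrightarrow> reach n f k' (c + c') T"
proof (induction rule: reach.induct)
  case (refl c)
  then show ?case by (rule reach_mono) simp
qed (auto intro: reach.intros)

lemma reach_uniform_draw:
  "finite S \<Longrightarrow> S \<noteq> {} \<Longrightarrow> (\<And>a. a \<in> S \<Longrightarrow> reach n f k c (K a)) \<Longrightarrow>
    reach n f k c (draw (pmf_of_set S) K)"
  unfolding draw_def by (intro reach.draw) auto

text \<open>At most \<open>c\<close> calls are spent before \<open>k\<close> starts, and a run that
  rejects instead has stayed within the budget.\<close>

lemma reach_bad:
  assumes "reach n f k c T" "ones n f \<noteq> {}"
  shows "bad n f T (c + B) \<le> bad n f k B"
  using assms
proof (induction rule: reach.induct)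
  case (refl c)
  show ?case by (rule bad_antimono) simp
qed (auto simp: bad_nonneg intro: bad_Sample_le bad_Draw_le)

lemma reach_acc:
  assumes "reach n f k c T" "ones n f \<noteq> {}"
  shows "acc n f T \<le> acc n f k"
  using assms
  by (induction rule: reach.induct) (auto simp: acc_nonneg intro: acc_Sample_le acc_Draw_le)

lemma reach_safe:
  assumes "reach n f k c T" "ones n f \<noteq> {}" "unate n f" "safe n f k"
  shows "safe n f T"
  using assms
  by (induction rule: reach.induct) (auto simp: set_SAMP safe_def)

section \<open>Searching for two oppositely oriented sensitive edges\<close>

lemma MQ_iff: "MQ n f x \<longleftrightarrow> x \<in> ones n f"
  by (simp add: MQ_def)

text \<open>The only place where the tester rejects. All four values are queried here, so the error
  is one-sided whatever \<open>u\<close>, \<open>v\<close> and \<open>i\<close> the searches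
  supply.\<close>

definition verify :: "bool list \<Rightarrow> bool list \<Rightarrow> nat \<Rightarrow> tester \<Rightarrow> tester" where
  "verify u v i k = (if u ! i = v ! i then k else
     Query u (\<lambda>a. Query (flip {i} u) (\<lambda>b. Query v (\<lambda>c. Query (flip {i} v) (\<lambda>d.
       if a \<and> \<not> b \<and> c \<and> \<not> d then Halt False else k)))))"

lemma not_unate_if_sens:
  assumes "u \<in> sens n f i True" "v \<in> sens n f i False"
  shows "\<not> unate n f"
proof -
  have i: "i < n"
  proof (rule ccontr)
    \<comment> \<open>For an index out of range \<open>flip\<close> is the identity, so no point is
      sensitive.\<close>
    assume "\<not> i < n"
    moreover have "length u = n" using assms by (simp add: sens_def ones_def cube_def)
    ultimately have "flip {i} u = u" by (intro nth_equalityI) auto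
    then show False using assms by (auto simp: sens_def)
  qed
  have l: "length u = n" "length v = n" using assms by (simp_all add: sens_def ones_def cube_def)
  have eqs: "u[i := True] = u" "u[i := False] = flip {i} u" "v[i := False] = v" "v[i := True] = flip {i} v"
    using assms l i by (auto intro!: nth_equalityI simp: nth_list_update sens_def split: if_splits)
  have "\<not> f (u[i := True]) \<le> f (u[i := False])" "\<not> f (v[i := False]) \<le> f (v[i := True])"
    "u \<in> cube n" "v \<in> cube n"
    using assms l unfolding eqs by (auto simp: sens_def ones_def cube_def)
  then show ?thesis using i unfolding unate_def by blast
qed

lemma verify_rejects:
  assumes "u \<in> sens n f i c" "v \<in> sens n f i (\<not> c)"
  shows "acc n f (verify u v i k) = 0" "bad n f (verify u v i k) (4 + B) = 0"
  using assms by (auto simp: verify_def sens_def MQ_iff numeral_eq_Suc)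

lemma reach_verify: "reach n f k 4 (verify u v i k)"
proof -
  have "\<not> unate n f" if "u ! i \<noteq> v ! i" "u \<in> ones n f" "flip {i} u \<notin> ones n f"
    "v \<in> ones n f" "flip {i} v \<notin> ones n f"
    using not_unate_if_sens[of u n f i v] not_unate_if_sens[of v n f i u] that
    by (cases "u ! i") (auto simp: sens_def)
  then have "reach n f k 0 (if u \<in> ones n f \<and> flip {i} u \<notin> ones n f \<and> v \<in> ones n f \<and>
      flip {i} v \<notin> ones n f then Halt False else k)" if "u ! i \<noteq> v ! i"
    using that by (simp add: reach.refl reach.reject)
  then show ?thesis
    by (auto simp: verify_def MQ_iff numeral_eq_Suc intro: reach.refl intro!: reach.query)
qed

text \<open>Sublists of a distinct \<open>Q\<close> represent its subsets, so each draw is a uniform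
  subset.\<close>

primrec probe :: "nat \<Rightarrow> bool list \<Rightarrow> nat list \<Rightarrow> (nat list \<Rightarrow> tester) \<Rightarrow> tester \<Rightarrow> tester" where
  "probe 0 x Q s k = k"
| "probe (Suc r) x Q s k = draw (pmf_of_set (set (List.subseqs Q)))
     (\<lambda>A. Query (flip (set A) x) (\<lambda>b. if b then probe r x Q s k else s A))"

text \<open>Invariant: \<open>y\<close> is a one, flipping all of \<open>A\<close> gives a zero, and
  \<open>length A \<le> 2 ^ m\<close>. At \<open>m = 0\<close> the list is a singleton, and its
  entry is a sensitive coordinate of \<open>y\<close>.\<close>

primrec bsearch :: "nat \<Rightarrow> bool list \<Rightarrow> nat list \<Rightarrow> (bool list \<Rightarrow> nat \<Rightarrow> tester) \<Rightarrow> tester" where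
  "bsearch 0 y A s = s y (hd A)"
| "bsearch (Suc m) y A s = (let A1 = take (2 ^ m) A in Query (flip (set A1) y)
     (\<lambda>b. if b then bsearch m (flip (set A1) y) (drop (2 ^ m) A) s else bsearch m y A1 s))"

text \<open>Removing each coordinate found from \<open>Q\<close> forces the later ones to be new;
  \<open>P\<close> pairs every coordinate with a point sensitive there.\<close>

primrec collect :: "nat \<Rightarrow> nat \<Rightarrow> nat \<Rightarrow> bool list \<Rightarrow> nat list \<Rightarrow> (nat \<times> bool list) list \<Rightarrow>
    ((nat \<times> bool list) list \<Rightarrow> tester) \<Rightarrow> tester \<Rightarrow> tester" where
  "collect 0 r m x Q P s k = s P"
| "collect (Suc c) r m x Q P s k = probe r x Q (\<lambda>A. bsearch m x A
     (\<lambda>y i. collect c r m x (remove1 i Q) ((i, y) # P) s k)) k"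

text \<open>The parameter \<open>h\<close> of the introduction is \<open>2 ^ j\<close>, and
  \<open>S\<close> will be \<open>diff x z\<close>.\<close>

definition level :: "nat \<Rightarrow> nat \<Rightarrow> bool list \<Rightarrow> bool list \<Rightarrow> nat list \<Rightarrow> tester \<Rightarrow> tester" where
  "level r j x z S k = collect (2 ^ j) r (Suc j) x (take (2 ^ Suc j) S) []
     (\<lambda>P. probe r z (map fst P) (\<lambda>B. bsearch (Suc j) z B
       (\<lambda>y i. verify y (the (map_of P i)) i k)) k) k"

lemma subseqs_ne: "set (List.subseqs Q) \<noteq> {}"
  by (metis subseqs_refl empty_iff)

lemma reach_probe:
  assumes "\<And>A. reach n f k c (s A)"
  shows "reach n f k (r + c) (probe r x Q s k)"
proof (induction r)
  case 0
  show ?case by (simp add: reach.refl)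
next
  case (Suc r)
  have "reach n f k (r + c) (s A)" for A using assms reach_mono by (metis le_add2)
  then show ?case using Suc
    by (auto intro!: reach_uniform_draw subseqs_ne reach.query)
qed

lemma reach_bsearch:
  assumes "\<And>y i. reach n f k c (s y i)"
  shows "reach n f k (m + c) (bsearch m y A s)"
  by (induction m arbitrary: y A) (auto simp: assms Let_def intro!: reach.query)

lemma reach_collect:
  assumes "\<And>P. reach n f k c (s P)"
  shows "reach n f k (a * (r + m) + c) (collect a r m x Q P s k)"
proof (induction a arbitrary: Q P)
  case 0
  show ?case by (simp add: assms)
next
  case (Suc a)
  have "reach n f k (r + (m + (a * (r + m) + c))) (collect (Suc a) r m x Q P s k)"
    by (simp, intro reach_probe reach_bsearch Suc.IH)
  then show ?case by (simp add: algebra_simps)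
qed

text \<open>\<open>2 ^ j\<close> rounds of \<open>r\<close> probes and a binary search of depth
  \<open>Suc j\<close>, one such round from \<open>z\<close>, and the four queries of
  \<open>verify\<close>.\<close>

definition level_cost :: "nat \<Rightarrow> nat \<Rightarrow> nat" where
  "level_cost r j = 2 ^ j * (r + Suc j) + (r + (Suc j + 4))"

lemma reach_level: "reach n f k (level_cost r j) (level r j x z S k)"
  unfolding level_def level_cost_def
  by (intro reach_collect reach_probe reach_bsearch reach_verify)

section \<open>Certifying that two ones are close\<close>

lemma distinct_subseqs: "distinct Q \<Longrightarrow> distinct (List.subseqs Q) \<and> inj_on set (set (List.subseqs Q))"
  using distinct_set_subseqs[of Q] by (simp add: distinct_map)

lemma card_subseqs: "distinct Q \<Longrightarrow> card (set (List.subseqs Q)) = 2 ^ length Q"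
  using distinct_subseqs[of Q] by (simp add: distinct_card length_subseqs)

lemma set_subseqsD: "A \<in> set (List.subseqs Q) \<Longrightarrow> set A \<subseteq> set Q"
  using subseqs_powset[of Q] by (metis PowD imageI)

lemma nonneg_factor:
  fixes \<theta> :: real
  assumes "real m \<le> \<theta> * 2 ^ h"
  shows "0 \<le> \<theta>"
proof (rule ccontr)
  assume "\<not> 0 \<le> \<theta>"
  then have "\<theta> * 2 ^ h < 0" by (intro mult_neg_pos) auto
  then show False using assms by linarith
qed

text \<open>Different subsets of \<open>Q\<close> lead to different points, so at most
  \<open>card (ones n f)\<close> of the \<open>2 ^ length Q\<close> subsets keep the value 1. One
  probe thus fails with probability at most \<open>\<theta>\<close>; after \<open>r\<close> failures
  only the trivial bound 1 is used for \<open>k\<close>.\<close>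

lemma bad_probe:
  fixes \<theta> p :: real
  assumes x: "length x = n" and Q: "distinct Q" "set Q \<subseteq> {..<n}"
    and \<theta>: "card (ones n f) \<le> \<theta> * 2 ^ length Q" and p: "0 \<le> p"
    and s: "\<And>A. A \<in> set (List.subseqs Q) \<Longrightarrow> flip (set A) x \<notin> ones n f \<Longrightarrow> bad n f (s A) B \<le> p"
  shows "bad n f (probe r x Q s k) (r + B) \<le> p + \<theta> ^ r"
proof (induction r)
  case 0
  show ?case using bad_le_1[of n f k B] p by simp
next
  case (Suc r)
  let ?S = "set (List.subseqs Q)"
  let ?I = "{A \<in> ?S. flip (set A) x \<in> ones n f}"
  have "inj_on (\<lambda>A. flip (set A) x) ?I"
  proof (rule inj_onI)
    fix A A' assume A: "A \<in> ?I" "A' \<in> ?I" "flip (set A) x = flip (set A') x"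
    then have "set A = set A'"
      using flip_inj_set[of "set A" x "set A'"] set_subseqsD Q x by blast
    then show "A = A'" using distinct_subseqs[OF Q(1)] A by (auto dest: inj_onD)
  qed
  then have "card ?I \<le> card (ones n f)"
    by (rule card_inj_on_le) (auto simp: finite_ones)
  then have I: "card ?I \<le> \<theta> * card ?S"
    using \<theta> by (simp add: card_subseqs Q)
  have \<theta>0: "\<theta> ^ r \<ge> 0" using nonneg_factor[OF \<theta>] by simp
  have "(\<Sum>A\<in>?S. bad n f (Query (flip (set A) x) (\<lambda>b. if b then probe r x Q s k else s A)) (Suc (r + B)))
      \<le> (\<Sum>A\<in>?S. p + (if A \<in> ?I then \<theta> ^ r else 0))"
  proof (rule sum_mono)
    fix A assume A: "A \<in> ?S"
    have "bad n f (s A) (r + B) \<le> p" if "flip (set A) x \<notin> ones n f"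
      using s[OF A that] bad_antimono[of B "r + B" n f "s A"] by simp
    then show "bad n f (Query (flip (set A) x) (\<lambda>b. if b then probe r x Q s k else s A)) (Suc (r + B))
        \<le> p + (if A \<in> ?I then \<theta> ^ r else 0)"
      using Suc A by (simp add: MQ_iff)
  qed
  also have "\<dots> = p * card ?S + card ?I * \<theta> ^ r"
  proof -
    have "(\<Sum>A\<in>?S. if A \<in> ?I then \<theta> ^ r else 0) = sum (\<lambda>_. \<theta> ^ r) ?I"
      by (simp add: sum.inter_filter[symmetric])
    then show ?thesis by (simp add: sum.distrib)
  qed
  also have "\<dots> \<le> p * card ?S + \<theta> * card ?S * \<theta> ^ r"
    using I \<theta>0 by (intro add_left_mono mult_right_mono)
  also have "\<dots> = (p + \<theta> ^ Suc r) * card ?S"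
    by (simp add: algebra_simps)
  finally have *: "(\<Sum>A\<in>?S. bad n f (Query (flip (set A) x) (\<lambda>b. if b then probe r x Q s k else s A)) (Suc (r + B)))
      \<le> (p + \<theta> ^ Suc r) * card ?S" .
  have "real (card ?S) > 0" by (simp add: card_subseqs Q)
  then show ?case
    unfolding probe.simps add_Suc bad_draw_uniform[OF finite_set subseqs_ne]
    using * by (subst pos_divide_le_eq)
qed

text \<open>Besides the halving invariant, coordinates still in the list have not been flipped. So
  the edge found has at \<open>i\<close> the value of the starting point, which fixes its
  orientation.\<close>

lemma bad_bsearch:
  assumes "length A \<le> 2 ^ m" "distinct A" "set A \<subseteq> {..<n}" "y \<in> ones n f" "flip (set A) y \<notin> ones n f"
    and "\<And>i y'. i \<in> set A \<Longrightarrow> y' \<in> sens n f i (y ! i) \<Longrightarrow> bad n f (s y' i) B \<le> p"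
  shows "bad n f (bsearch m y A s) (m + B) \<le> p"
  using assms
proof (induction m arbitrary: y A)
  case 0
  have "A \<noteq> []" using 0 by auto
  then obtain i where A: "A = [i]" using 0 by (cases A) auto
  then have "y \<in> sens n f i (y ! i)" using 0 by (simp add: sens_def)
  then show ?case using 0 A by simp
next
  case (Suc m)
  let ?A1 = "take (2 ^ m) A" and ?A2 = "drop (2 ^ m) A"
  have A: "set A = set ?A1 \<union> set ?A2" by (metis append_take_drop_id set_append)
  have dj: "set ?A1 \<inter> set ?A2 = {}" using Suc.prems(2) by (metis append_take_drop_id distinct_append)
  have ly: "length y = n" using Suc.prems(4) by (simp add: ones_def cube_def)
  show ?case
  proof (cases "flip (set ?A1) y \<in> ones n f")
    case True
    have "flip (set ?A2) (flip (set ?A1) y) = flip (set A) y"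
      using dj A by (subst flip_flip_disjoint) (auto simp: Un_commute)
    moreover have "flip (set ?A1) y ! i = y ! i" if "i \<in> set ?A2" for i
    proof -
      have "i < length y" "i \<notin> set ?A1" using that dj A Suc.prems(3) ly by auto
      then show ?thesis by simp
    qed
    ultimately have "bad n f (bsearch m (flip (set ?A1) y) ?A2 s) (m + B) \<le> p"
      using Suc.prems True A by (intro Suc.IH) auto
    then show ?thesis using True by (simp add: Let_def MQ_iff)
  next
    case False
    then have "bad n f (bsearch m y ?A1 s) (m + B) \<le> p"
      using Suc.prems A by (intro Suc.IH) auto
    then show ?thesis using False by (simp add: Let_def MQ_iff)
  qed
qed

text \<open>By \<open>a + h \<le> length Q\<close> at least \<open>h\<close> coordinates remain at
  every probe, so each of the \<open>a\<close> rounds fails with probability at most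
  \<open>\<theta> ^ r\<close>, and the failures add up.\<close>

lemma bad_collect:
  fixes \<theta> p :: real
  assumes x: "x \<in> ones n f" and \<theta>: "card (ones n f) \<le> \<theta> * 2 ^ h" and p: "0 \<le> p"
    and s: "\<And>P. length P = h \<Longrightarrow> distinct (map fst P) \<Longrightarrow> fst ` set P \<subseteq> R \<Longrightarrow>
      (\<forall>(i, y) \<in> set P. y \<in> sens n f i (x ! i)) \<Longrightarrow> bad n f (s P) B \<le> p"
    and R: "R \<subseteq> {..<n}"
    and "length P + a = h" "distinct (map fst P)" "fst ` set P \<subseteq> R - set Q"
      "\<forall>(i, y) \<in> set P. y \<in> sens n f i (x ! i)"
      "distinct Q" "set Q \<subseteq> R" "a + h \<le> length Q" "length Q \<le> 2 ^ m"
  shows "bad n f (collect a r m x Q P s k) (a * (r + m) + B) \<le> p + a * \<theta> ^ r"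
  using assms(6-)
proof (induction a arbitrary: Q P)
  case 0
  then have "bad n f (s P) B \<le> p" by (intro s) auto
  then show ?case by simp
next
  case (Suc a)
  have xn: "length x = n" using x by (simp add: ones_def cube_def)
  note \<theta>0 = nonneg_factor[OF \<theta>]
  have "(2::real) ^ h \<le> 2 ^ length Q" using Suc.prems by (intro power_increasing) auto
  then have "\<theta> * 2 ^ h \<le> \<theta> * 2 ^ length Q" using \<theta>0 by (rule mult_left_mono)
  then have N: "card (ones n f) \<le> \<theta> * 2 ^ length Q" using \<theta> by linarith
  have p': "0 \<le> p + a * \<theta> ^ r" using p \<theta>0 by simp
  have "bad n f (bsearch m x A (\<lambda>y i. collect a r m x (remove1 i Q) ((i, y) # P) s k))
      (m + (a * (r + m) + B)) \<le> p + a * \<theta> ^ r"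
    if A: "A \<in> set (List.subseqs Q)" "flip (set A) x \<notin> ones n f" for A
  proof (rule bad_bsearch[OF _ _ _ x A(2)])
    have AQ: "set A \<subseteq> set Q" "distinct A"
      using set_subseqsD[OF A(1)] subseqs_distinctD[OF A(1)] Suc.prems by auto
    then have "length A \<le> length Q" using Suc.prems by (metis distinct_card card_mono finite_set)
    then show "length A \<le> 2 ^ m" "distinct A" "set A \<subseteq> {..<n}"
      using AQ Suc.prems R by auto
    fix i y assume iy: "i \<in> set A" "y \<in> sens n f i (x ! i)"
    then have iQ: "i \<in> set Q" using AQ by auto
    show "bad n f (collect a r m x (remove1 i Q) ((i, y) # P) s k) (a * (r + m) + B) \<le> p + a * \<theta> ^ r"
      using Suc.prems iy iQ
      by (intro Suc.IH) (auto simp: length_remove1)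
  qed
  then have "bad n f (collect (Suc a) r m x Q P s k) (r + (m + (a * (r + m) + B)))
      \<le> (p + a * \<theta> ^ r) + \<theta> ^ r"
    using Suc.prems R unfolding collect.simps
    by (intro bad_probe[OF xn _ _ N p']) auto
  then show ?case by (simp add: algebra_simps)
qed

text \<open>The coordinates found from the side of \<open>x\<close> fill half of the block, and the search from
  \<open>z\<close> inside them must end in one of them: this yields two oppositely sensitive edges.\<close>

lemma bad_level:
  fixes \<theta> :: real
  assumes x: "x \<in> ones n f" and z: "z \<in> ones n f"
    and \<theta>: "card (ones n f) \<le> \<theta> * 2 ^ (2 ^ j)" and len: "2 ^ Suc j \<le> length (diff x z)"
  shows "bad n f (level r j x z (diff x z) k) (level_cost r j) \<le> (2 ^ j + 1) * \<theta> ^ r"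
proof -
  let ?R = "set (diff x z)"
  have xn: "length x = n" and zn: "length z = n" using x z by (simp_all add: ones_def cube_def)
  have R: "?R \<subseteq> {..<n}" using xn by (auto simp: diff_def)
  have d: "distinct (diff x z)" by (simp add: diff_def)
  note \<theta>0 = nonneg_factor[OF \<theta>]
  let ?s = "\<lambda>P. probe r z (map fst P) (\<lambda>B. bsearch (Suc j) z B
       (\<lambda>y i. verify y (the (map_of P i)) i k)) k"
  have "bad n f (?s P) (r + (Suc j + 4)) \<le> \<theta> ^ r"
    if P: "length P = 2 ^ j" "distinct (map fst P)" "fst ` set P \<subseteq> ?R"
      "\<forall>(i, y) \<in> set P. y \<in> sens n f i (x ! i)" for P
  proof -
    have "bad n f (bsearch (Suc j) z A (\<lambda>y i. verify y (the (map_of P i)) i k)) (Suc j + 4) \<le> 0"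
      if A: "A \<in> set (List.subseqs (map fst P))" "flip (set A) z \<notin> ones n f" for A
    proof (rule bad_bsearch[OF _ _ _ z A(2)])
      have AP: "set A \<subseteq> fst ` set P" "distinct A"
        using set_subseqsD[OF A(1)] subseqs_distinctD[OF A(1)] P(2) by auto
      then have "card (set A) \<le> card (fst ` set P)" by (intro card_mono) auto
      also have "\<dots> \<le> length P" by (metis card_length length_map list.set_map)
      finally have "length A \<le> 2 ^ j" using AP P(1) by (simp add: distinct_card)
      then show "length A \<le> 2 ^ Suc j" by simp
      show "distinct A" "set A \<subseteq> {..<n}" using AP P(3) R by auto
      fix i y assume iy: "i \<in> set A" "y \<in> sens n f i (z ! i)"
      then obtain y' where y': "map_of P i = Some y'"
        using AP by (metis map_of_eq_None_iff not_None_eq subsetD)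
      then have iP: "(i, y') \<in> set P" by (rule map_of_SomeD)
      then have "y' \<in> sens n f i (x ! i)" using P(4) by auto
      moreover have "i \<in> ?R" using iP P(3) by force
      then have "x ! i = (\<not> z ! i)" by (auto simp: diff_def)
      ultimately have "y' \<in> sens n f i (\<not> z ! i)" by simp
      then show "bad n f (verify y (the (map_of P i)) i k) 4 \<le> 0"
        using verify_rejects(2)[OF iy(2), of y' k 0] y' by simp
    qed
    moreover have "card (ones n f) \<le> \<theta> * 2 ^ length (map fst P)" using \<theta> P by simp
    ultimately have "bad n f (?s P) (r + (Suc j + 4)) \<le> 0 + \<theta> ^ r"
      using P R zn by (intro bad_probe) auto
    then show ?thesis by simp
  qed
  \<comment> \<open>Each of the \<open>2 ^ j\<close> rounds from \<open>x\<close> and the one from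
    \<open>z\<close> contributes \<open>\<theta> ^ r\<close>.\<close>
  then have "bad n f (level r j x z (diff x z) k) (2 ^ j * (r + Suc j) + (r + (Suc j + 4)))
      \<le> \<theta> ^ r + real (2 ^ j) * \<theta> ^ r"
    unfolding level_def using len d set_take_subset[of "2 ^ Suc j" "diff x z"] \<theta>0
    by (intro bad_collect[OF x \<theta>, where R = ?R]) (auto simp: R)
  then show ?thesis by (simp add: level_cost_def algebra_simps)
qed

section \<open>Trials\<close>

text \<open>\<open>u\<close> and \<open>v\<close> are the candidates with coordinate
  \<open>i\<close> true and false, replaced by fresh sensitive samples. In a trial \<open>x\<close>
  starts as both, and so serves its own side if it is sensitive.\<close>

primrec scan :: "nat \<Rightarrow> nat \<Rightarrow> bool list \<Rightarrow> bool list \<Rightarrow> tester \<Rightarrow> tester" where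
  "scan 0 i u v k = verify u v i k"
| "scan (Suc b) i u v k = Sample (\<lambda>y. Query (flip {i} y) (\<lambda>a.
     if a then scan b i u v k else if y ! i then scan b i y v k else scan b i u y k))"

definition trial :: "bool list \<Rightarrow> nat \<Rightarrow> tester \<Rightarrow> tester" where
  "trial z b k = Sample (\<lambda>x. if diff x z = [] then k
     else Draw (pmf_of_set (set (diff x z))) (\<lambda>i. scan b i x x k))"

lemma reach_scan: "reach n f k (2 * b + 4) (scan b i u v k)"
proof (induction b arbitrary: u v)
  case 0
  show ?case by (simp add: reach_verify)
next
  case (Suc b)
  have "reach n f k (Suc (Suc (2 * b + 4))) (scan (Suc b) i u v k)"
    unfolding scan.simps by (intro reach.sample reach.query) (simp add: Suc)
  then show ?case by simp
qed

lemma reach_trial: "reach n f k (2 * b + 5) (trial z b k)"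
proof -
  have "reach n f k (Suc (2 * b + 4)) (trial z b k)"
    unfolding trial_def
  proof (rule reach.sample)
    show "reach n f k (2 * b + 4) (if diff x z = [] then k
        else Draw (pmf_of_set (set (diff x z))) (\<lambda>i. scan b i x x k))" for x
      by (auto intro!: reach.draw reach_scan intro: reach.refl)
  qed
  then show ?thesis by (rule reach_mono) simp
qed

definition freq :: "nat \<Rightarrow> (bool list \<Rightarrow> bool) \<Rightarrow> nat \<Rightarrow> bool \<Rightarrow> real" where
  "freq n f i c = card (sens n f i c) / card (ones n f)"

text \<open>A union bound for the event that \<open>b\<close> further samples leave one side without
  a sensitive point; a side already served contributes 0.\<close>

definition miss :: "nat \<Rightarrow> (bool list \<Rightarrow> bool) \<Rightarrow> nat \<Rightarrow> nat \<Rightarrow> bool list \<Rightarrow> bool list \<Rightarrow> real" where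
  "miss n f b i u v = (if u \<in> sens n f i True then 0 else (1 - freq n f i True) ^ b) +
     (if v \<in> sens n f i False then 0 else (1 - freq n f i False) ^ b)"

text \<open>A lower bound for the probability that one trial rejects. The minimum truncates the
  union bound at 1; an empty \<open>diff x z\<close> contributes 0 as a division by zero.\<close>

definition hit :: "nat \<Rightarrow> (bool list \<Rightarrow> bool) \<Rightarrow> bool list \<Rightarrow> nat \<Rightarrow> real" where
  "hit n f z b = (\<Sum>x\<in>ones n f. (\<Sum>i\<in>set (diff x z). 1 - min 1 (miss n f b i x x)) /
     length (diff x z)) / card (ones n f)"

lemma distinct_diff: "distinct (diff x z)"
  by (simp add: diff_def)

lemma card_set_diff: "card (set (diff x z)) = length (diff x z)"
  by (simp add: distinct_card distinct_diff)

context
  fixes n :: nat and f :: "bool list \<Rightarrow> bool"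
  assumes ne: "ones n f \<noteq> {}"
begin

lemma card_ones_pos: "0 < card (ones n f)"
  using ne by (simp add: finite_ones card_gt_0_iff)

lemma freq_nonneg: "0 \<le> freq n f i c" and freq_le_1: "freq n f i c \<le> 1"
  using card_mono[OF finite_ones, of "sens n f i c" n f] card_ones_pos
  by (auto simp: freq_def sens_def)

text \<open>A sample lies in \<open>sens i True\<close> and \<open>sens i False\<close> with the respective frequencies, so the
  expectation of \<open>miss\<close> after one more sample is exactly \<open>miss\<close> with a larger exponent.\<close>

lemma miss_step:
  "(\<Sum>y\<in>ones n f. if y \<in> sens n f i True then miss n f b i y v
      else if y \<in> sens n f i False then miss n f b i u y else miss n f b i u v)
    = card (ones n f) * miss n f (Suc b) i u v" (is "?L = ?R")
proof -
  let ?O = "ones n f" and ?T = "sens n f i True" and ?F = "sens n f i False"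
  define t where "t = (if u \<in> ?T then 0 else (1 - freq n f i True) ^ b)"
  define w where "w = (if v \<in> ?F then 0 else (1 - freq n f i False) ^ b)"
  have TF: "?T \<subseteq> ?O" "?F \<subseteq> ?O" "?T \<inter> ?F = {}" by (auto simp: sens_def)
  have "?L = (\<Sum>y\<in>?O. (t + w) - (if y \<in> ?T then t else 0) - (if y \<in> ?F then w else 0))"
    using TF by (intro sum.cong) (auto simp: miss_def t_def w_def)
  also have "\<dots> = card ?O * (t + w) - card ?T * t - card ?F * w"
    using TF by (simp add: sum_subtractf sum.inter_restrict[symmetric] finite_ones Int_absorb1)
  also have "\<dots> = card ?O * ((1 - freq n f i True) * t + (1 - freq n f i False) * w)"
    using card_ones_pos by (simp add: freq_def field_simps)
  also have "\<dots> = ?R"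
    by (simp add: miss_def t_def w_def)
  finally show ?thesis .
qed

lemma acc_scan: "acc n f (scan b i u v k) \<le> miss n f b i u v * acc n f k"
proof (induction b arbitrary: u v)
  case 0
  show ?case
  proof (cases "u \<in> sens n f i True \<and> v \<in> sens n f i False")
    case True
    then show ?thesis using verify_rejects(1)[of u n f i True v k] by (simp add: miss_def)
  next
    case False
    \<comment> \<open>With no samples left, an unserved side contributes a power with exponent 0,
      that is 1.\<close>
    then have "1 \<le> miss n f 0 i u v" by (auto simp: miss_def)
    then have "1 * acc n f k \<le> miss n f 0 i u v * acc n f k"
      by (intro mult_right_mono acc_nonneg)
    then show ?thesis using reach_acc[OF reach_verify[of n f k u v i] ne] by simp
  qed
next
  case (Suc b)
  let ?O = "ones n f"
  have "(\<Sum>y\<in>?O. acc n f (Query (flip {i} y) (\<lambda>a.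
     if a then scan b i u v k else if y ! i then scan b i y v k else scan b i u y k)))
    \<le> (\<Sum>y\<in>?O. (if y \<in> sens n f i True then miss n f b i y v
      else if y \<in> sens n f i False then miss n f b i u y else miss n f b i u v) * acc n f k)"
    using Suc by (intro sum_mono) (auto simp: MQ_iff sens_def)
  also have "\<dots> = card ?O * miss n f (Suc b) i u v * acc n f k"
    by (simp add: miss_step sum_distrib_right[symmetric])
  finally show ?case
    using card_ones_pos by (simp add: acc_Sample[OF ne] field_simps)
qed

lemma acc_trial: "acc n f (trial z b k) \<le> (1 - hit n f z b) * acc n f k"
proof -
  let ?O = "ones n f"
  let ?\<sigma> = "\<lambda>x i. 1 - min 1 (miss n f b i x x)"
  let ?t = "\<lambda>x. if diff x z = [] then k
     else Draw (pmf_of_set (set (diff x z))) (\<lambda>i. scan b i x x k)"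
  have "acc n f (?t x) \<le> acc n f k - (\<Sum>i\<in>set (diff x z). ?\<sigma> x i) / length (diff x z) * acc n f k" for x
  proof (cases "diff x z = []")
    case False
    have "(\<Sum>i\<in>set (diff x z). acc n f (scan b i x x k)) \<le> (\<Sum>i\<in>set (diff x z). (1 - ?\<sigma> x i) * acc n f k)"
    proof (rule sum_mono)
      fix i
      \<comment> \<open>\<open>acc_scan\<close> gives the bound by \<open>miss\<close> and
        \<open>reach_acc\<close> the bound by 1; together they give the minimum.\<close>
      show "acc n f (scan b i x x k) \<le> (1 - ?\<sigma> x i) * acc n f k"
        using acc_scan[of b i x x k] reach_acc[OF reach_scan[of n f k b i x x] ne]
        by (simp add: min_def)
    qed
    also have "\<dots> = length (diff x z) * acc n f k - (\<Sum>i\<in>set (diff x z). ?\<sigma> x i) * acc n f k"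
      by (simp add: card_set_diff sum_subtractf sum_distrib_right left_diff_distrib)
    finally show ?thesis
      using False by (simp add: acc_Draw_uniform card_set_diff field_simps)
  qed simp
  then have "(\<Sum>x\<in>?O. acc n f (?t x))
      \<le> (\<Sum>x\<in>?O. acc n f k - (\<Sum>i\<in>set (diff x z). ?\<sigma> x i) / length (diff x z) * acc n f k)"
    by (rule sum_mono)
  also have "\<dots> = card ?O * acc n f k - card ?O * hit n f z b * acc n f k"
    using card_ones_pos by (simp add: hit_def sum_subtractf sum_distrib_right)
  finally show ?thesis
    using card_ones_pos by (simp add: trial_def acc_Sample[OF ne] field_simps)
qed

lemma acc_trials: "acc n f (foldr (trial z) bs (Halt True)) \<le> exp (- (\<Sum>b\<leftarrow>bs. hit n f z b))"
proof (induction bs)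
  case (Cons b bs)
  have "acc n f (foldr (trial z) (b # bs) (Halt True))
      \<le> (1 - hit n f z b) * acc n f (foldr (trial z) bs (Halt True))"
    using acc_trial by simp
  also have "\<dots> \<le> exp (- hit n f z b) * acc n f (foldr (trial z) bs (Halt True))"
    using exp_ge_add_one_self[of "- hit n f z b"] by (intro mult_right_mono acc_nonneg) simp
  also have "\<dots> \<le> exp (- hit n f z b) * exp (- (\<Sum>b\<leftarrow>bs. hit n f z b))"
    using Cons by (intro mult_left_mono) auto
  finally show ?case by (simp add: exp_add[symmetric])
qed simp

end

text \<open>A harmonic schedule: for every unknown frequency \<open>q\<close> it contains about
  \<open>M * q\<close> budgets of size at least \<open>1 / q\<close>, at total size O(M log M). The
  \<open>+ 1\<close> makes up for rounding down.\<close>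

definition budgets :: "nat \<Rightarrow> nat list" where
  "budgets M = map (\<lambda>j. M div Suc j + 1) [0..<M]"

lemma sum_card_swap:
  assumes "finite A" "finite B"
  shows "(\<Sum>x\<in>A. card {i \<in> B. P x i}) = (\<Sum>i\<in>B. card {x \<in> A. P x i})"
proof -
  have "(\<Sum>x\<in>A. card {i \<in> B. P x i}) = (\<Sum>x\<in>A. \<Sum>i\<in>B. of_bool (P x i))"
    using assms by (intro sum.cong) (simp_all add: Int_def)
  also have "\<dots> = (\<Sum>i\<in>B. \<Sum>x\<in>A. of_bool (P x i))" by (rule sum.swap)
  also have "\<dots> = (\<Sum>i\<in>B. card {x \<in> A. P x i})"
    using assms by (intro sum.cong) (simp_all add: Int_def)
  finally show ?thesis .
qed

text \<open>If \<open>Suc j \<le> M * q\<close>, then the budget with index \<open>j\<close> exceeds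
  \<open>M / Suc j\<close>, which is at least \<open>1 / q\<close>. The number of such indices is
  the floor of \<open>M * q\<close>.\<close>

lemma harmonic_count:
  fixes q :: real
  assumes "0 \<le> q" "q \<le> 1"
  shows "M * q - 1 \<le> card {j \<in> {..<M}. 1 \<le> real (M div Suc j + 1) * q}"
proof -
  have "{..<nat \<lfloor>M * q\<rfloor>} \<subseteq> {j \<in> {..<M}. 1 \<le> real (M div Suc j + 1) * q}"
  proof
    fix j assume "j \<in> {..<nat \<lfloor>M * q\<rfloor>}"
    then have j: "real (Suc j) \<le> M * q" by (simp add: le_floor_iff nat_less_iff le_nat_iff) linarith
    have "M < Suc j * (M div Suc j + 1)"
      using dividend_less_div_times[of "Suc j" M] by (simp add: algebra_simps)
    then have "real M \<le> real (Suc j) * real (M div Suc j + 1)"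
      by (metis less_imp_le of_nat_le_iff of_nat_mult)
    then have "M * q \<le> real (Suc j) * real (M div Suc j + 1) * q"
      using assms by (intro mult_right_mono) auto
    then have "real (Suc j) * 1 \<le> real (Suc j) * (real (M div Suc j + 1) * q)"
      using j unfolding mult.assoc mult_1_right by (rule order_trans[rotated])
    then have 1: "1 \<le> real (M div Suc j + 1) * q"
      by (rule mult_left_le_imp_le) simp
    have "M * q \<le> real M" using assms by (simp add: mult_left_le)
    then have "j < M" using j by linarith
    then show "j \<in> {j \<in> {..<M}. 1 \<le> real (M div Suc j + 1) * q}" using 1 by simp
  qed
  then have "nat \<lfloor>M * q\<rfloor> \<le> card {j \<in> {..<M}. 1 \<le> real (M div Suc j + 1) * q}"
    using card_mono[of "{j \<in> {..<M}. 1 \<le> real (M div Suc j + 1) * q}" "{..<nat \<lfloor>M * q\<rfloor>}"] by simp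
  then show ?thesis by linarith
qed

section \<open>Detection for functions far from unate\<close>

lemma exp_ge_5_halves: "5 / 2 \<le> exp (1::real)"
  using exp_lower_Taylor_quadratic[of 1] by simp

lemma exp_ge_5: "5 \<le> exp (2::real)"
  using exp_lower_Taylor_quadratic[of 2] by simp

text \<open>Bounding \<open>exp (- 1)\<close> by 2/5 makes two sides together miss with probability
  at most 4/5.\<close>

lemma power_one_minus_le:
  fixes q :: real
  assumes "q \<le> 1" "1 \<le> b * q"
  shows "(1 - q) ^ b \<le> 2 / 5"
proof -
  have "(1 - q) ^ b \<le> exp (- q) ^ b"
    using exp_ge_add_one_self[of "- q"] assms by (intro power_mono) auto
  also have "\<dots> = exp (- (b * q))"
    by (simp add: exp_of_nat_mult[symmetric])
  also have "\<dots> \<le> exp (- 1)"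
    using assms by simp
  also have "\<dots> \<le> 2 / 5"
    using exp_ge_5_halves by (simp add: exp_minus field_simps)
  finally show ?thesis .
qed

text \<open>\<open>z\<close> is the reference sample and \<open>d\<close> a radius that all but a
  fraction \<open>\<epsilon> / 10\<close> of the ones respect; later it is the distance of the
  farthest sample seen.\<close>

locale far_instance =
  fixes n :: nat and f :: "bool list \<Rightarrow> bool" and \<epsilon> :: real and z :: "bool list" and d :: nat
  assumes ne: "ones n f \<noteq> {}" and \<epsilon>: "0 < \<epsilon>" "\<epsilon> < 1" and far: "reldist_unate n f > \<epsilon>"
    and zn: "length z = n"
    and outliers: "card {x \<in> ones n f. d < length (diff x z)} \<le> \<epsilon> / 10 * card (ones n f)"
begin

abbreviation "N \<equiv> real (card (ones n f))"

definition "T = {i \<in> {..<n}. N \<le> 4 * real (card {x \<in> ones n f. x ! i \<noteq> z ! i})}"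

definition "near = {x \<in> ones n f. length (diff x z) \<le> d}"

text \<open>The set deleted in \<open>far_from_unate\<close>.\<close>

definition "H = {x \<in> ones n f. card (set (diff x z) - T) > d}"

definition "m i = min (card (sens n f i True)) (card (sens n f i False))"

lemma N_pos: "0 < N"
  using card_ones_pos[OF ne] by simp

lemma T: "T \<subseteq> {..<n}" "finite T"
  by (auto simp: T_def)

lemma diff_eq: "x \<in> ones n f \<Longrightarrow> set (diff x z) = {i \<in> {..<n}. x ! i \<noteq> z ! i}"
  by (auto simp: diff_def ones_def cube_def)

text \<open>At least a quarter of the ones differ from \<open>z\<close> at \<open>i\<close> and at
  most a tenth are outliers; \<open>3 / 20\<close> is the difference.\<close>

lemma near_T:
  assumes "i \<in> T"
  shows "3 / 20 * N \<le> card {x \<in> near. x ! i \<noteq> z ! i}"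
proof -
  have "card {x \<in> ones n f. x ! i \<noteq> z ! i}
      \<le> card ({x \<in> near. x ! i \<noteq> z ! i} \<union> {x \<in> ones n f. d < length (diff x z)})"
    by (intro card_mono) (auto simp: near_def finite_ones)
  also have "\<dots> \<le> card {x \<in> near. x ! i \<noteq> z ! i} + card {x \<in> ones n f. d < length (diff x z)}"
    by (rule card_Un_le)
  finally have "real (card {x \<in> ones n f. x ! i \<noteq> z ! i})
      \<le> card {x \<in> near. x ! i \<noteq> z ! i} + \<epsilon> / 10 * N"
    using outliers by linarith
  moreover have "N \<le> 4 * real (card {x \<in> ones n f. x ! i \<noteq> z ! i})"
    using assms by (simp add: T_def)
  moreover have "\<epsilon> / 10 * N \<le> 1 / 10 * N" using \<epsilon> by (intro mult_right_mono) auto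
  ultimately show ?thesis by linarith
qed

text \<open>Double counting of the pairs of a near \<open>x\<close> and an \<open>i \<in> T\<close>
  with \<open>x ! i \<noteq> z ! i\<close>: each \<open>i\<close> has at least
  \<open>3 / 20 * N\<close> partners, each \<open>x\<close> at most \<open>d\<close>.\<close>

lemma card_T: "3 * card T \<le> 20 * real d"
proof -
  have "card T * (3 / 20 * N) \<le> (\<Sum>i\<in>T. real (card {x \<in> near. x ! i \<noteq> z ! i}))"
    using near_T by (intro sum_bounded_below)
  also have "\<dots> = real (\<Sum>x\<in>near. card {i \<in> T. x ! i \<noteq> z ! i})"
    using sum_card_swap[of near T "\<lambda>x i. x ! i \<noteq> z ! i"] T by (simp add: near_def finite_ones)
  also have "\<dots> \<le> real (\<Sum>x\<in>near. d)"
  proof (intro of_nat_mono sum_mono)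
    fix x assume x: "x \<in> near"
    have "card {i \<in> T. x ! i \<noteq> z ! i} \<le> card (set (diff x z))"
      using T x by (intro card_mono) (auto simp: diff_eq near_def)
    then show "card {i \<in> T. x ! i \<noteq> z ! i} \<le> d"
      using x by (simp add: near_def card_set_diff)
  qed
  also have "\<dots> \<le> N * d"
    using card_mono[OF finite_ones, of near n f] by (auto simp: near_def intro!: mult_right_mono)
  finally have "N * (3 / 20 * card T) \<le> N * d" by (simp add: mult_ac)
  then have "3 / 20 * card T \<le> real d"
    using N_pos by (rule mult_left_le_imp_le)
  then show ?thesis by simp
qed

lemma H_le: "card H \<le> \<epsilon> / 10 * N"
proof -
  have "card H \<le> card {x \<in> ones n f. d < length (diff x z)}"
  proof (rule card_mono)
    show "H \<subseteq> {x \<in> ones n f. d < length (diff x z)}"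
      using card_mono[of "set (diff _ z)" "set (diff _ z) - T"]
      by (fastforce simp: H_def card_set_diff[symmetric] intro: less_le_trans)
  qed (simp add: finite_ones)
  then show ?thesis using outliers by linarith
qed

text \<open>\<open>H\<close> takes at most \<open>\<epsilon> / 10 * N\<close>; half of the remaining
  \<open>9 / 10\<close> gives \<open>9 / 20\<close>.\<close>

lemma sensitive_mass:
  "9 / 20 * \<epsilon> * N < (\<Sum>i\<in>T. real (m i)) + (\<Sum>i\<in>{..<n} - T. real (card (sens n f i (\<not> z ! i) - H)))"
proof -
  have "\<epsilon> * N < real (card H + 2 * ((\<Sum>i\<in>T. m i) + (\<Sum>i\<in>{..<n} - T. card (sens n f i (\<not> z ! i) - H))))"
    using far_from_unate[OF far ne T(1) zn, of d] unfolding H_def m_def .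
  then show ?thesis using H_le by (simp add: field_simps)
qed

text \<open>For \<open>d = 0\<close> the set \<open>T\<close> is empty and \<open>H\<close> contains
  every one that differs from \<open>z\<close>, so no sensitive mass would be left.\<close>

lemma d_pos: "0 < d"
proof (rule ccontr)
  assume "\<not> 0 < d"
  then have d: "d = 0" by simp
  then have "T = {}" using card_T T by simp
  moreover have "card (sens n f i (\<not> z ! i) - H) = 0" if i: "i \<in> {..<n} - T" for i
  proof -
    have "x \<in> H" if x: "x \<in> sens n f i (\<not> z ! i)" for x
    proof -
      have "i \<in> set (diff x z) - T" using x i by (auto simp: sens_def diff_eq)
      then have "d < card (set (diff x z) - T)" using d by (auto simp: card_gt_0_iff)
      then show ?thesis using x unfolding H_def sens_def by blast
    qed
    then have "sens n f i (\<not> z ! i) - H = {}" by blast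
    then show ?thesis by (metis card.empty)
  qed
  ultimately have "9 / 20 * \<epsilon> * N < 0" using sensitive_mass by simp
  moreover have "0 \<le> 9 / 20 * \<epsilon> * N" using \<epsilon> by simp
  ultimately show False by linarith
qed

text \<open>A trial draws a given \<open>x \<in> X\<close> together with a given \<open>i\<close> in
  \<open>diff x z\<close> with probability at least \<open>1 / (N * c)\<close>, and if
  \<open>P x i\<close> holds with \<open>i \<in> I\<close> it then succeeds with probability at
  least \<open>w\<close>.\<close>

lemma hit_ge:
  assumes X: "X \<subseteq> ones n f" "\<And>x. x \<in> X \<Longrightarrow> length (diff x z) \<le> c"
    and I: "I \<subseteq> {..<n}"
    and w: "0 \<le> w" "\<And>x i. x \<in> X \<Longrightarrow> i \<in> I \<Longrightarrow> P x i \<Longrightarrow> x ! i \<noteq> z ! i \<and> miss n f b i x x \<le> 1 - w"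
  shows "w / c * (\<Sum>i\<in>I. real (card {x \<in> X. P x i})) \<le> N * hit n f z b"
proof -
  let ?\<sigma> = "\<lambda>x i. 1 - min 1 (miss n f b i x x)"
  have fin: "finite X" "finite I" using X I finite_subset finite_ones by blast+
  have \<sigma>: "0 \<le> ?\<sigma> x i" for x i by simp
  have "w / c * (\<Sum>i\<in>I. real (card {x \<in> X. P x i})) = w / c * real (\<Sum>x\<in>X. card {i \<in> I. P x i})"
    using sum_card_swap[OF fin] by simp
  also have "\<dots> = (\<Sum>x\<in>X. w / c * card {i \<in> I. P x i})"
    by (simp add: sum_distrib_left)
  also have "\<dots> \<le> (\<Sum>x\<in>X. (\<Sum>i\<in>set (diff x z). ?\<sigma> x i) / length (diff x z))"
  proof (rule sum_mono)
    fix x assume x: "x \<in> X"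
    have sub: "{i \<in> I. P x i} \<subseteq> set (diff x z)"
      using w(2)[OF x] I diff_eq[of x] X(1) x by blast
    show "w / c * card {i \<in> I. P x i} \<le> (\<Sum>i\<in>set (diff x z). ?\<sigma> x i) / length (diff x z)"
    proof (cases "diff x z = []")
      case True
      then have "card {i \<in> I. P x i} = 0"
        using sub by (metis card.empty list.set(1) subset_empty)
      then show ?thesis using True by simp
    next
      case False
      then have l: "0 < length (diff x z)" by simp
      then have c: "0 < c" using X(2)[OF x] by linarith
      have "w * card {i \<in> I. P x i} = (\<Sum>i\<in>{i \<in> I. P x i}. w)" by simp
      also have "\<dots> \<le> (\<Sum>i\<in>{i \<in> I. P x i}. ?\<sigma> x i)"
        using w x by (intro sum_mono) (force simp: min_def)
      also have "\<dots> \<le> (\<Sum>i\<in>set (diff x z). ?\<sigma> x i)"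
        using sub by (intro sum_mono2) auto
      finally have *: "w * card {i \<in> I. P x i} \<le> (\<Sum>i\<in>set (diff x z). ?\<sigma> x i)" .
      have "w * card {i \<in> I. P x i} / c \<le> w * card {i \<in> I. P x i} / length (diff x z)"
      proof (rule divide_left_mono)
        show "0 < real c * real (length (diff x z))" using c l by (intro mult_pos_pos) simp_all
      qed (use X(2)[OF x] w(1) in simp_all)
      also have "\<dots> \<le> (\<Sum>i\<in>set (diff x z). ?\<sigma> x i) / length (diff x z)"
        using * by (intro divide_right_mono) auto
      finally show ?thesis by simp
    qed
  qed
  also have "\<dots> \<le> (\<Sum>x\<in>ones n f. (\<Sum>i\<in>set (diff x z). ?\<sigma> x i) / length (diff x z))"
    using X(1) by (intro sum_mono2) (auto simp: finite_ones intro!: divide_nonneg_nonneg sum_nonneg)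
  also have "\<dots> = N * hit n f z b"
    using N_pos by (simp add: hit_def)
  finally show ?thesis .
qed

text \<open>The edges in a direction \<open>i\<close> that are not sensitive pair up samples on both sides of \<open>z ! i\<close>;
  hence outside \<open>T\<close> more than half of all samples are sensitive and on the side of \<open>z\<close>.\<close>

lemma freq_outside_T:
  assumes i: "i \<in> {..<n} - T"
  shows "1 / 2 \<le> freq n f i (z ! i)"
proof -
  let ?A = "{x \<in> ones n f. x ! i \<noteq> z ! i}" and ?B = "{x \<in> ones n f. x ! i = z ! i \<and> flip {i} x \<in> ones n f}"
  have "flip {i} ` ?B \<subseteq> ?A" using i by (auto simp: ones_def cube_def)
  then have "card ?B \<le> card ?A"
    by (intro card_inj_on_le[OF inj_on_subset[OF inj_flip]]) (auto simp: finite_ones)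
  moreover have "card (ones n f) = card ?A + card (?B \<union> sens n f i (z ! i))"
    by (subst card_Un_disjoint[symmetric])
      (auto simp: finite_ones finite_sens sens_def intro!: arg_cong[of _ _ card])
  moreover have "card (?B \<union> sens n f i (z ! i)) \<le> card ?B + card (sens n f i (z ! i))"
    by (rule card_Un_le)
  moreover have "4 * real (card ?A) < N" using i by (auto simp: T_def)
  ultimately have "N \<le> 2 * real (card (sens n f i (z ! i)))" by linarith
  then show ?thesis using N_pos by (simp add: freq_def field_simps)
qed

text \<open>The drawn \<open>x\<close> is itself sensitive on the side opposite to \<open>z\<close>,
  and the other side has frequency at least 1/2, so one fresh sample succeeds with probability 1/2.
  Points outside \<open>H\<close> differ from \<open>z\<close> in at most
  \<open>d + card T \<le> 8 * d\<close> coordinates; hence \<open>16 * d\<close>.\<close>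

lemma hit_outside_T:
  assumes b: "1 \<le> b"
  shows "(\<Sum>i\<in>{..<n} - T. real (card (sens n f i (\<not> z ! i) - H))) / (16 * d) \<le> N * hit n f z b"
proof -
  have len: "length (diff x z) \<le> 8 * d" if x: "x \<in> ones n f - H" for x
  proof -
    have "length (diff x z) = card ((set (diff x z) - T) \<union> (set (diff x z) \<inter> T))"
      by (simp add: card_set_diff[symmetric] Un_Diff_Int)
    also have "\<dots> \<le> card (set (diff x z) - T) + card (set (diff x z) \<inter> T)"
      by (rule card_Un_le)
    also have "\<dots> \<le> d + card T"
      using x T by (intro add_mono card_mono) (auto simp: H_def)
    finally show ?thesis using card_T by linarith
  qed
  have "miss n f b i x x \<le> 1 - 1 / 2"
    if i: "i \<in> {..<n} - T" and x: "x \<in> sens n f i (\<not> z ! i)" for x i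
  proof -
    have "(1 - freq n f i (z ! i)) ^ b \<le> (1 - freq n f i (z ! i)) ^ 1"
      using b freq_nonneg[OF ne] freq_le_1[OF ne] by (intro power_decreasing) auto
    then have "(1 - freq n f i (z ! i)) ^ b \<le> 1 / 2" using freq_outside_T[OF i] by simp
    then show ?thesis using x by (cases "z ! i") (auto simp: miss_def sens_def)
  qed
  then have "1 / 2 / real (8 * d) *
      (\<Sum>i\<in>{..<n} - T. real (card {x \<in> ones n f - H. x \<in> sens n f i (\<not> z ! i)})) \<le> N * hit n f z b"
    using len by (intro hit_ge) (auto simp: sens_def)
  moreover have "{x \<in> ones n f - H. x \<in> sens n f i (\<not> z ! i)} = sens n f i (\<not> z ! i) - H" for i
    by (auto simp: sens_def)
  ultimately show ?thesis by simp
qed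

text \<open>Both sides come from fresh samples, each missed with probability at most 2/5, so
  \<open>x\<close> only has to be near and to differ from \<open>z\<close> at \<open>i\<close>. The
  constant is \<open>1 / 5 * (3 / 20)\<close>.\<close>

lemma hit_T: "3 / (100 * d) * card {i \<in> T. 1 \<le> b * (m i / N)} \<le> hit n f z b"
proof -
  let ?I = "{i \<in> T. 1 \<le> b * (m i / N)}"
  have miss: "miss n f b i x x \<le> 1 - 1 / 5" if i: "i \<in> ?I" for x i
  proof -
    have "(1 - freq n f i c) ^ b \<le> 2 / 5" for c
    proof (rule power_one_minus_le)
      have "m i / N \<le> freq n f i c"
        using N_pos by (cases c) (auto simp: m_def freq_def intro!: divide_right_mono)
      then have "b * (m i / N) \<le> b * freq n f i c" by (rule mult_left_mono) simp
      then show "1 \<le> b * freq n f i c" using i by simp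
    qed (rule freq_le_1[OF ne])
    from this[of True] this[of False] show ?thesis by (simp add: miss_def)
  qed
  have "1 / 5 / d * (card ?I * (3 / 20 * N)) \<le> 1 / 5 / d * (\<Sum>i\<in>?I. real (card {x \<in> near. x ! i \<noteq> z ! i}))"
    using near_T by (intro mult_left_mono sum_bounded_below) auto
  also have "\<dots> \<le> N * hit n f z b"
    using T miss by (intro hit_ge) (auto simp: near_def)
  finally have "N * (3 / (100 * d) * card ?I) \<le> N * hit n f z b"
    by (simp add: mult_ac)
  then show ?thesis using N_pos by (rule mult_left_le_imp_le)
qed

lemma sum_hits:
  assumes M: "400 * d / \<epsilon> \<le> real M"
  shows "2 \<le> (\<Sum>b\<leftarrow>budgets M. hit n f z b)"
proof -
  have S: "(\<Sum>b\<leftarrow>budgets M. hit n f z b) = (\<Sum>j<M. hit n f z (M div Suc j + 1))"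
    unfolding budgets_def map_map interv_sum_list_conv_sum_set_nat
    by (simp add: lessThan_atLeast0)
  have M\<epsilon>: "400 * d \<le> M * \<epsilon>" using M \<epsilon> by (simp add: field_simps)
  have d: "0 < real d" using d_pos by simp
  \<comment> \<open>The mass \<open>9 / 20\<close> is split as \<open>1 / 5 + 1 / 4\<close>. In the
    first case every one of the \<open>M\<close> trials has \<open>hit\<close> at least
    \<open>\<epsilon> / (80 * d)\<close>.\<close>
  show ?thesis
  proof (cases "\<epsilon> / 5 * N \<le> (\<Sum>i\<in>{..<n} - T. real (card (sens n f i (\<not> z ! i) - H)))")
    case True
    have "\<epsilon> / (80 * d) \<le> hit n f z b" if "1 \<le> b" for b
    proof -
      have "\<epsilon> / 5 * N / (16 * d) \<le> N * hit n f z b"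
        using hit_outside_T[OF that] True d
        by (meson divide_right_mono mult_nonneg_nonneg of_nat_0_le_iff order_trans zero_le_numeral)
      then have "N * (\<epsilon> / (80 * d)) \<le> N * hit n f z b" by (simp add: mult_ac)
      then show ?thesis using N_pos by (rule mult_left_le_imp_le)
    qed
    then have "real (card {..<M}) * (\<epsilon> / (80 * d)) \<le> (\<Sum>j<M. hit n f z (M div Suc j + 1))"
      by (intro sum_bounded_below) auto
    moreover have "2 \<le> M * (\<epsilon> / (80 * d))"
      using M\<epsilon> d by (simp add: field_simps)
    ultimately show ?thesis using S by simp
  next
    case False
    then have m: "\<epsilon> / 4 * N < (\<Sum>i\<in>T. real (m i))"
      using sensitive_mass by linarith
    have mq: "0 \<le> m i / N" "m i / N \<le> 1" for i
      using freq_le_1[OF ne, of i True] N_pos by (auto simp: m_def freq_def field_simps)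
    \<comment> \<open>\<open>M * \<epsilon> / 4\<close> is at least \<open>100 * d\<close> and
      \<open>card T\<close> at most \<open>20 * d / 3\<close>, so the product is at least
      2.8.\<close>
    have "2 \<le> 3 / (100 * d) * (M * (\<epsilon> / 4) - card T)"
      using M\<epsilon> d card_T by (simp add: field_simps)
    also have "\<dots> \<le> 3 / (100 * d) * (\<Sum>i\<in>T. M * (m i / N) - 1)"
    proof (intro mult_left_mono)
      have "\<epsilon> / 4 \<le> (\<Sum>i\<in>T. real (m i)) / N" using m N_pos by (simp add: field_simps)
      then have "M * (\<epsilon> / 4) \<le> M * ((\<Sum>i\<in>T. real (m i)) / N)" by (rule mult_left_mono) simp
      then show "M * (\<epsilon> / 4) - card T \<le> (\<Sum>i\<in>T. M * (m i / N) - 1)"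
        by (simp add: sum_subtractf sum_distrib_left sum_divide_distrib)
    qed simp
    \<comment> \<open>For each direction \<open>harmonic_count\<close> counts the budgets large
      enough for it; swapping the sums yields directions per budget, as in
      \<open>hit_T\<close>.\<close>
    also have "\<dots> \<le> 3 / (100 * d) * (\<Sum>i\<in>T. real (card {j \<in> {..<M}. 1 \<le> real (M div Suc j + 1) * (m i / N)}))"
      using harmonic_count[OF mq] by (intro mult_left_mono sum_mono) auto
    also have "\<dots> = 3 / (100 * d) * real (\<Sum>j<M. card {i \<in> T. 1 \<le> real (M div Suc j + 1) * (m i / N)})"
      using sum_card_swap[OF finite_lessThan T(2), of "\<lambda>j i. 1 \<le> real (M div Suc j + 1) * (m i / N)"]
      by simp
    also have "\<dots> = (\<Sum>j<M. 3 / (100 * d) * card {i \<in> T. 1 \<le> real (M div Suc j + 1) * (m i / N)})"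
      by (simp only: of_nat_sum sum_distrib_left)
    also have "\<dots> \<le> (\<Sum>j<M. hit n f z (M div Suc j + 1))"
      using hit_T by (intro sum_mono) blast
    finally show ?thesis using S by simp
  qed
qed

end

section \<open>The tester\<close>

text \<open>Chosen so that \<open>2 ^ j / 2 * tries \<delta> j \<ge> 2 * 2 ^ j + log 2 (1 /
  \<delta>)\<close>. Dividing by \<open>2 ^ j\<close> keeps the cost of a level additive in
  \<open>log 2 (1 / \<delta>)\<close>.\<close>

definition tries :: "real \<Rightarrow> nat \<Rightarrow> nat" where
  "tries \<delta> j = nat \<lceil>4 + 2 * log 2 (1 / \<delta>) / 2 ^ j\<rceil>"

text \<open>Levels come in increasing order, so those before the decisive one are cheap; the filter
  keeps the levels whose block fits into \<open>diff x z\<close>.\<close>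

definition certify :: "real \<Rightarrow> bool list \<Rightarrow> bool list \<Rightarrow> tester \<Rightarrow> tester" where
  "certify \<delta> z x = foldr (\<lambda>j. level (tries \<delta> j) j x z (diff x z))
     (filter (\<lambda>j. 2 ^ Suc j \<le> length (diff x z)) [0..<length (diff x z)])"

definition main :: "real \<Rightarrow> real \<Rightarrow> bool list \<Rightarrow> bool list \<Rightarrow> tester" where
  "main \<epsilon> \<delta> z x = certify \<delta> z x
     (foldr (trial z) (budgets (nat \<lceil>400 * length (diff x z) / \<epsilon>\<rceil>)) (Halt True))"

primrec farthest :: "nat \<Rightarrow> bool list \<Rightarrow> bool list \<Rightarrow> (bool list \<Rightarrow> tester) \<Rightarrow> tester" where
  "farthest 0 z x K = K x"
| "farthest (Suc s) z x K =
     Sample (\<lambda>y. farthest s z (if length (diff x z) < length (diff y z) then y else x) K)"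

text \<open>For a single one \<open>log N = 0\<close>, so the bound does not allow
  \<open>40 / \<epsilon>\<close> samples. Repeated copies of \<open>z\<close> therefore lead to
  acceptance, which is right since such an \<open>f\<close> is never far from unate.\<close>

primrec if_another_one :: "nat \<Rightarrow> bool list \<Rightarrow> tester \<Rightarrow> tester" where
  "if_another_one 0 z k = Halt True"
| "if_another_one (Suc r) z k = Sample (\<lambda>x. if x = z then if_another_one r z k else k)"

definition unate_tester :: "real \<Rightarrow> real \<Rightarrow> tester" where
  "unate_tester \<epsilon> \<delta> =
     Sample (\<lambda>z. if_another_one 6 z (farthest (nat \<lceil>40 / \<epsilon>\<rceil>) z z (main \<epsilon> \<delta> z)))"

lemma reach_foldr:
  assumes "\<And>a k. reach n f k (c a) (g a k)"
  shows "reach n f k (\<Sum>a\<leftarrow>as. c a) (foldr g as k)"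
  by (induction as) (auto intro: reach.refl reach_trans[OF assms])

lemma reach_certify:
  "reach n f k (\<Sum>j\<leftarrow>filter (\<lambda>j. 2 ^ Suc j \<le> length (diff x z)) [0..<length (diff x z)].
     level_cost (tries \<delta> j) j) (certify \<delta> z x k)"
  unfolding certify_def by (rule reach_foldr) (rule reach_level)

lemma reach_trials:
  "reach n f k (\<Sum>b\<leftarrow>bs. 2 * b + 5) (foldr (trial z) bs k)"
  by (rule reach_foldr) (rule reach_trial)

text \<open>As \<open>log N \<le> 2 ^ j / 2\<close>, \<open>bad_level\<close> applies with
  \<open>\<theta> = 2 powr (- (2 ^ j / 2))\<close>. The factor \<open>2 ^ j + 1\<close> is absorbed
  by \<open>2 powr (2 ^ j)\<close>.\<close>

lemma bad_level_le:
  assumes x: "x \<in> ones n f" and z: "z \<in> ones n f" and \<delta>: "0 < \<delta>" "\<delta> < 1"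
    and j: "2 * log 2 (card (ones n f)) \<le> 2 ^ j" and len: "2 ^ Suc j \<le> length (diff x z)"
  shows "bad n f (level (tries \<delta> j) j x z (diff x z) k) (level_cost (tries \<delta> j) j) \<le> \<delta>"
proof -
  define P :: real where "P = 2 ^ j"
  define r where "r = tries \<delta> j"
  let ?N = "real (card (ones n f))"
  have N: "0 < ?N" using x by (auto simp: card_gt_0_iff finite_ones)
  have P: "1 \<le> P" "P = real (2 ^ j)" by (simp_all add: P_def)
  have "?N = 2 powr log 2 ?N" using N by simp
  also have "\<dots> \<le> 2 powr (P / 2)" using j by (intro powr_mono) (auto simp: P_def)
  also have "\<dots> = 2 powr (- (P / 2)) * 2 powr P" by (simp add: powr_add[symmetric])
  also have "2 powr P = 2 ^ (2 ^ j)" unfolding P(2) by (rule powr_realpow) simp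
  finally have "bad n f (level r j x z (diff x z) k) (level_cost r j)
      \<le> (2 ^ j + 1) * (2 powr (- (P / 2))) ^ r"
    by (intro bad_level[OF x z _ len])
  also have "\<dots> = (P + 1) * 2 powr (- (P / 2) * r)"
    by (simp add: P_def powr_realpow[symmetric] powr_powr)
  also have "\<dots> \<le> 2 powr P * 2 powr (- (P / 2) * r)"
  proof (intro mult_right_mono)
    have "2 ^ j + 1 \<le> (2::nat) ^ (2 ^ j)" by (metis Suc_eq_plus1 Suc_le_eq less_exp)
    then have "real (2 ^ j + 1) \<le> 2 powr P"
      unfolding P(2) powr_realpow[OF zero_less_numeral] by (metis of_nat_le_iff of_nat_numeral of_nat_power)
    then show "P + 1 \<le> 2 powr P" by (simp add: P_def)
  qed simp
  also have "\<dots> = 2 powr (P - P / 2 * r)"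
    by (simp add: powr_add[symmetric])
  also have "\<dots> \<le> 2 powr (- log 2 (1 / \<delta>))"
  proof (intro powr_mono)
    have "4 + 2 * log 2 (1 / \<delta>) / P \<le> r"
      unfolding r_def tries_def P_def by (rule real_nat_ceiling_ge)
    then have "P / 2 * (4 + 2 * log 2 (1 / \<delta>) / P) \<le> P / 2 * r"
      using P by (intro mult_left_mono) auto
    moreover have "P / 2 * (4 + 2 * log 2 (1 / \<delta>) / P) = 2 * P + log 2 (1 / \<delta>)"
      using P(1) by (simp add: field_simps)
    ultimately show "P - P / 2 * r \<le> - log 2 (1 / \<delta>)" using P(1) by linarith
  qed simp
  also have "\<dots> = \<delta>"
    using \<delta> by (simp add: log_divide powr_minus)
  finally show ?thesis by (simp add: r_def)
qed

definition trial_cost :: "nat \<Rightarrow> nat" where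
  "trial_cost M = (\<Sum>b\<leftarrow>budgets M. 2 * b + 5)"

lemma trial_cost_sum: "trial_cost M = (\<Sum>j<M. 2 * (M div Suc j) + 7)"
  unfolding trial_cost_def budgets_def map_map interv_sum_list_conv_sum_set_nat
  by (simp add: lessThan_atLeast0 add.commute)

lemma trial_cost_mono:
  assumes "M \<le> M'"
  shows "trial_cost M \<le> trial_cost M'"
proof -
  have "(\<Sum>j<M. 2 * (M div Suc j) + 7) \<le> (\<Sum>j<M. 2 * (M' div Suc j) + 7)"
    using assms by (intro sum_mono add_mono mult_left_mono div_le_mono) auto
  also have "\<dots> \<le> (\<Sum>j<M'. 2 * (M' div Suc j) + 7)"
    using assms by (intro sum_mono2) auto
  finally show ?thesis by (simp add: trial_cost_sum)
qed

text \<open>If \<open>diff x z\<close> has at least \<open>2 ^ Suc j\<close> coordinates, the run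
  ends within the levels up to \<open>j\<close> except with probability \<open>\<delta>\<close>.
  Otherwise only levels below \<open>j\<close> are run and the budget holds for every run.\<close>

lemma bad_main:
  assumes x: "x \<in> ones n f" and z: "z \<in> ones n f" and \<delta>: "0 < \<delta>" "\<delta> < 1" and \<epsilon>: "0 < \<epsilon>"
    and j: "2 * log 2 (card (ones n f)) \<le> 2 ^ j"
  shows "bad n f (main \<epsilon> \<delta> z x) ((\<Sum>i<Suc j. level_cost (tries \<delta> i) i) +
    trial_cost (nat \<lceil>400 * 2 ^ Suc j / \<epsilon>\<rceil>)) \<le> \<delta>"
proof -
  let ?l = "length (diff x z)" and ?c = "\<lambda>i. level_cost (tries \<delta> i) i"
  let ?js = "filter (\<lambda>j. 2 ^ Suc j \<le> ?l) [0..<?l]"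
  let ?k = "foldr (trial z) (budgets (nat \<lceil>400 * ?l / \<epsilon>\<rceil>)) (Halt True)"
  have ne: "ones n f \<noteq> {}" using x by auto
  show ?thesis
  proof (cases "2 ^ Suc j \<le> ?l")
    case True
    have jl: "j < ?l" using True less_exp[of "Suc j"] by linarith
    have "[0..<?l] = [0..<j] @ j # [Suc j..<?l]"
      using jl upt_add_eq_append[of 0 j "?l - j"] by (simp add: upt_conv_Cons)
    moreover have "filter (\<lambda>j. 2 ^ Suc j \<le> ?l) [0..<j] = [0..<j]"
    proof (rule filter_True, intro ballI)
      fix i assume "i \<in> set [0..<j]"
      then have "(2::nat) ^ Suc i \<le> 2 ^ Suc j" by (intro power_increasing) auto
      then show "2 ^ Suc i \<le> ?l" using True by linarith
    qed
    ultimately have js: "?js = [0..<j] @ j # filter (\<lambda>j. 2 ^ Suc j \<le> ?l) [Suc j..<?l]"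
      using True by simp
    let ?k' = "foldr (\<lambda>j. level (tries \<delta> j) j x z (diff x z))
      (filter (\<lambda>j. 2 ^ Suc j \<le> ?l) [Suc j..<?l]) ?k"
    have main: "main \<epsilon> \<delta> z x = foldr (\<lambda>j. level (tries \<delta> j) j x z (diff x z)) [0..<j]
        (level (tries \<delta> j) j x z (diff x z) ?k')"
      unfolding main_def certify_def js by simp
    have "bad n f (main \<epsilon> \<delta> z x) ((\<Sum>i\<leftarrow>[0..<j]. ?c i) + ?c j)
        \<le> bad n f (level (tries \<delta> j) j x z (diff x z) ?k') (?c j)"
      unfolding main by (intro reach_bad[OF reach_foldr ne] reach_level)
    also have "\<dots> \<le> \<delta>" by (rule bad_level_le[OF x z \<delta> j True])
    finally have "bad n f (main \<epsilon> \<delta> z x) (\<Sum>i<Suc j. ?c i) \<le> \<delta>"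
      by (simp add: interv_sum_list_conv_sum_set_nat lessThan_atLeast0)
    moreover have "bad n f (main \<epsilon> \<delta> z x) ((\<Sum>i<Suc j. ?c i) +
        trial_cost (nat \<lceil>400 * 2 ^ Suc j / \<epsilon>\<rceil>)) \<le> bad n f (main \<epsilon> \<delta> z x) (\<Sum>i<Suc j. ?c i)"
      by (rule bad_antimono) simp
    ultimately show ?thesis by linarith
  next
    case False
    have "reach n f (Halt True) ((\<Sum>j\<leftarrow>?js. ?c j) + trial_cost (nat \<lceil>400 * ?l / \<epsilon>\<rceil>)) (main \<epsilon> \<delta> z x)"
      unfolding main_def trial_cost_def by (rule reach_trans[OF reach_certify reach_trials])
    moreover have "(\<Sum>j\<leftarrow>?js. ?c j) \<le> (\<Sum>i<Suc j. ?c i)"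
    proof -
      have "(\<Sum>j\<leftarrow>?js. ?c j) = (\<Sum>j\<in>set ?js. ?c j)"
        by (intro sum_list_distinct_conv_sum_set) simp
      also have "\<dots> \<le> (\<Sum>i<Suc j. ?c i)"
      proof (rule sum_mono2)
        show "set ?js \<subseteq> {..<Suc j}"
        proof
          fix i assume "i \<in> set ?js"
          then have "2 ^ Suc i \<le> ?l" by simp
          then have "(2::nat) ^ Suc i < 2 ^ Suc j" using False by linarith
          then have "Suc i < Suc j" by (rule power_less_imp_less_exp[rotated]) simp
          then show "i \<in> {..<Suc j}" by simp
        qed
      qed auto
      finally show ?thesis .
    qed
    moreover have "trial_cost (nat \<lceil>400 * ?l / \<epsilon>\<rceil>) \<le> trial_cost (nat \<lceil>400 * 2 ^ Suc j / \<epsilon>\<rceil>)"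
    proof -
      have "real ?l \<le> real (2 ^ Suc j)" using False by (intro of_nat_mono) linarith
      then have "400 * real ?l / \<epsilon> \<le> 400 * 2 ^ Suc j / \<epsilon>" using \<epsilon> by (intro divide_right_mono) simp_all
      then have "nat \<lceil>400 * real ?l / \<epsilon>\<rceil> \<le> nat \<lceil>400 * 2 ^ Suc j / \<epsilon>\<rceil>"
        by (intro nat_mono ceiling_mono)
      then show ?thesis by (intro trial_cost_mono) simp
    qed
    ultimately have "reach n f (Halt True) ((\<Sum>i<Suc j. ?c i) +
        trial_cost (nat \<lceil>400 * 2 ^ Suc j / \<epsilon>\<rceil>)) (main \<epsilon> \<delta> z x)"
      using reach_mono add_mono by blast
    from reach_bad[OF this ne, of 0] show ?thesis using \<delta> by simp
  qed
qed

text \<open>Certification can only lower acceptance, and trials with total \<open>hit\<close> at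
  least 2 leave \<open>exp (- 2)\<close>.\<close>

lemma acc_main:
  assumes "far_instance n f \<epsilon> z (length (diff x z))"
  shows "acc n f (main \<epsilon> \<delta> z x) \<le> 1 / 5"
proof -
  interpret far_instance n f \<epsilon> z "length (diff x z)" by (rule assms)
  let ?M = "nat \<lceil>400 * length (diff x z) / \<epsilon>\<rceil>"
  have "acc n f (main \<epsilon> \<delta> z x) \<le> acc n f (foldr (trial z) (budgets ?M) (Halt True))"
    unfolding main_def by (rule reach_acc[OF reach_certify ne])
  also have "\<dots> \<le> exp (- (\<Sum>b\<leftarrow>budgets ?M. hit n f z b))"
    by (rule acc_trials[OF ne])
  also have "\<dots> \<le> exp (- 2)"
    using sum_hits[OF real_nat_ceiling_ge] by simp
  also have "\<dots> \<le> 1 / 5"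
    using exp_ge_5 by (simp add: exp_minus field_simps)
  finally show ?thesis .
qed

context
  fixes n :: nat and f :: "bool list \<Rightarrow> bool"
  assumes ne: "ones n f \<noteq> {}"
begin

text \<open>A sample repeats \<open>z\<close> with probability
  \<open>1 / N \<le> 1 / 2\<close>.\<close>

lemma acc_if_another_one:
  assumes N: "2 \<le> card (ones n f)" and z: "z \<in> ones n f" and \<alpha>: "acc n f k \<le> \<alpha>" "0 \<le> \<alpha>"
  shows "acc n f (if_another_one r z k) \<le> \<alpha> + (1 / 2) ^ r"
proof (induction r)
  case (Suc r)
  let ?N = "real (card (ones n f))"
  have "(\<Sum>x\<in>ones n f. acc n f (if x = z then if_another_one r z k else k))
      \<le> (\<Sum>x\<in>ones n f. \<alpha> + (if x = z then (1 / 2) ^ r else 0))"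
    using Suc \<alpha> by (intro sum_mono) auto
  also have "\<dots> = ?N * \<alpha> + (1 / 2) ^ r"
    using z by (simp add: sum.distrib finite_ones)
  also have "\<dots> \<le> ?N * (\<alpha> + (1 / 2) ^ Suc r)"
    using N by (simp add: algebra_simps)
  finally show ?case
    using N by (simp add: acc_Sample[OF ne] field_simps)
qed (use \<alpha> in simp)

lemma bad_if_another_one:
  assumes "bad n f k B \<le> p" "0 \<le> p"
  shows "bad n f (if_another_one r z k) (r + B) \<le> p"
proof (induction r)
  case (Suc r)
  have "bad n f k (r + B) \<le> p" using assms(1) bad_antimono[of B "r + B" n f k] by simp
  then show ?case using Suc by (auto intro!: bad_Sample_le[OF ne])
qed (use assms in simp)

lemma bad_farthest:
  assumes "\<And>x. x \<in> ones n f \<Longrightarrow> bad n f (K x) B \<le> p" "x \<in> ones n f"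
  shows "bad n f (farthest s z x K) (s + B) \<le> p"
  using assms(2) by (induction s arbitrary: x) (auto simp: assms(1) intro!: bad_Sample_le[OF ne])

text \<open>Once the running maximum is a point of \<open>G\<close> it remains one, and every sample from \<open>G\<close>
  replaces a running maximum outside \<open>G\<close>.\<close>

lemma acc_farthest:
  fixes \<eta> :: real and z :: "bool list"
  defines "G \<equiv> {x \<in> ones n f. card {y \<in> ones n f. length (diff x z) < length (diff y z)} \<le> \<eta> * card (ones n f)}"
  assumes \<eta>: "0 \<le> \<eta>" "\<eta> \<le> 1" and K: "\<And>x. x \<in> G \<Longrightarrow> acc n f (K x) \<le> \<alpha>" and \<alpha>: "0 \<le> \<alpha>"
    and x: "x \<in> ones n f"
  shows "acc n f (farthest s z x K) \<le> \<alpha> + (1 - \<eta>) ^ s"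
proof -
  let ?O = "ones n f"
  let ?d = "\<lambda>x. length (diff x z)"
  have GO: "G \<subseteq> ?O" "finite G" by (auto simp: G_def finite_ones)
  have up: "y \<in> G" if "x \<in> G" "y \<in> ?O" "?d x \<le> ?d y" for x y
  proof -
    have "card {w \<in> ?O. ?d y < ?d w} \<le> card {w \<in> ?O. ?d x < ?d w}"
      using that by (intro card_mono) (auto simp: finite_ones)
    then have "real (card {w \<in> ?O. ?d y < ?d w}) \<le> real (card {w \<in> ?O. ?d x < ?d w})" by simp
    also have "\<dots> \<le> \<eta> * card ?O" using that(1) by (simp add: G_def)
    finally show ?thesis using that(2) by (simp add: G_def)
  qed
  \<comment> \<open>Take \<open>w\<close> farthest among the ones outside \<open>G\<close>.
    Everything strictly farther lies in \<open>G\<close>, and as \<open>w\<close> is not in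
    \<open>G\<close> there are more than \<open>\<eta> * card ?O\<close> such points.\<close>
  have cG: "\<eta> * card ?O \<le> card G"
  proof (cases "?O - G = {}")
    case True
    then have "G = ?O" using GO by auto
    then show ?thesis using \<eta> by (simp add: mult_left_le_one_le)
  next
    case False
    let ?m = "Max (?d ` (?O - G))"
    have fin: "finite (?d ` (?O - G))" by (simp add: finite_ones)
    obtain w where w: "w \<in> ?O - G" "?d w = ?m"
      using Max_in[OF fin] False by force
    have "{y \<in> ?O. ?d w < ?d y} \<subseteq> G"
      using Max_ge[OF fin] w(2) by (force simp: not_less[symmetric])
    then have "card {y \<in> ?O. ?d w < ?d y} \<le> card G" using GO by (intro card_mono)
    moreover have "\<eta> * card ?O < card {y \<in> ?O. ?d w < ?d y}" using w(1) by (simp add: G_def not_le)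
    ultimately show ?thesis by linarith
  qed
  have "acc n f (farthest s z x K) \<le> \<alpha> + (if x \<in> G then 0 else (1 - \<eta>) ^ s)"
    using x
  proof (induction s arbitrary: x)
    case 0
    show ?case using K acc_le_1[of n f "K x"] \<alpha> by (auto intro: order_trans)
  next
    case (Suc s)
    let ?next = "\<lambda>y. if ?d x < ?d y then y else x"
    let ?e = "(1 - \<eta>) ^ s"
    have e: "0 \<le> ?e" using \<eta> by simp
    have N: "0 < real (card ?O)" using card_ones_pos[OF ne] by simp
    have step: "acc n f (farthest s z (?next y) K) \<le> \<alpha> + (if ?next y \<in> G then 0 else ?e)"
      if "y \<in> ?O" for y
      using that Suc.prems by (intro Suc.IH) auto
    have "(\<Sum>y\<in>?O. acc n f (farthest s z (?next y) K))
        \<le> (\<Sum>y\<in>?O. \<alpha> + (if x \<in> G \<or> y \<in> G then 0 else ?e))"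
    proof (rule sum_mono)
      fix y assume y: "y \<in> ?O"
      have "?next y \<in> G" if "x \<in> G \<or> y \<in> G"
      proof (cases "x \<in> G")
        case True
        then show ?thesis using up[OF _ y] by simp
      next
        case False
        then have "y \<in> G" "?d x < ?d y" using that up[of y x] Suc.prems by (auto simp: not_less[symmetric])
        then show ?thesis by simp
      qed
      then show "acc n f (farthest s z (?next y) K) \<le> \<alpha> + (if x \<in> G \<or> y \<in> G then 0 else ?e)"
        using step[OF y] e by (auto split: if_splits)
    qed
    also have "\<dots> \<le> card ?O * (\<alpha> + (if x \<in> G then 0 else (1 - \<eta>) ^ Suc s))"
    proof (cases "x \<in> G")
      case False
      have "(\<Sum>y\<in>?O. \<alpha> + (if x \<in> G \<or> y \<in> G then 0 else ?e)) = (\<Sum>y\<in>?O. (\<alpha> + ?e) - (if y \<in> G then ?e else 0))"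
        using False by (intro sum.cong) auto
      also have "\<dots> = card ?O * (\<alpha> + ?e) - card G * ?e"
        using GO by (simp add: sum_subtractf sum.inter_restrict[symmetric] finite_ones Int_absorb1)
      also have "\<dots> \<le> card ?O * (\<alpha> + ?e) - \<eta> * card ?O * ?e"
        using cG e by (intro diff_left_mono mult_right_mono)
      also have "\<dots> = card ?O * (\<alpha> + (1 - \<eta>) ^ Suc s)"
        by (simp add: algebra_simps)
      finally show ?thesis using False by simp
    qed simp
    finally show ?case
      using N by (simp add: acc_Sample[OF ne] field_simps)
  qed
  also have "\<dots> \<le> \<alpha> + (1 - \<eta>) ^ s" using \<eta> by simp
  finally show ?thesis .
qed

end

section \<open>Arithmetic of the query bound\<close>

lemma harm_le_ln:
  assumes "0 < M"
  shows "(\<Sum>j<M. 1 / real (Suc j)) \<le> 1 + ln (real M)"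
proof -
  obtain m where M: "M = Suc m" using assms by (cases M) auto
  have "(\<Sum>j<M. 1 / real (Suc j)) = harm M"
    by (simp add: harm_def sum.atLeast1_atMost_eq inverse_eq_divide)
  moreover have "harm (Suc m) - ln (real (Suc m)) \<le> harm (Suc 0) - ln (real (Suc 0))"
    using decseq_harm_diff_ln by (rule decseqD) simp
  ultimately show ?thesis using M by (simp add: harm_def)
qed

lemma trial_cost_le:
  assumes "0 < M"
  shows "trial_cost M \<le> M * (9 + 2 * ln (real M))"
proof -
  have "real (trial_cost M) = (\<Sum>j<M. 2 * real (M div Suc j) + 7)"
    by (simp add: trial_cost_sum)
  also have "\<dots> \<le> (\<Sum>j<M. 2 * M * (1 / real (Suc j)) + 7)"
  proof (rule sum_mono)
    fix j
    show "2 * real (M div Suc j) + 7 \<le> 2 * M * (1 / real (Suc j)) + 7"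
      using of_nat_div_le_of_nat[of M "Suc j", where 'a = real] by simp
  qed
  also have "\<dots> = 2 * M * (\<Sum>j<M. 1 / real (Suc j)) + M * 7"
    by (simp add: sum.distrib sum_distrib_left)
  also have "\<dots> \<le> 2 * M * (1 + ln (real M)) + M * 7"
    using harm_le_ln[OF assms] by (intro add_right_mono mult_left_mono) auto
  finally show ?thesis by (simp add: algebra_simps)
qed

lemma ln_le_log2: "1 \<le> x \<Longrightarrow> ln x \<le> log 2 x"
  using ln_2_less_1 by (simp add: log_def field_simps mult_left_le)

lemma cost_bound:
  fixes L \<epsilon> \<delta> :: real
  assumes L: "1 \<le> L" and \<epsilon>: "0 < \<epsilon>" "\<epsilon> < 1" and \<delta>: "0 < \<delta>" "\<delta> < 1"
  obtains j where "2 * L \<le> 2 ^ j"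
    "real (Suc (6 + (nat \<lceil>40 / \<epsilon>\<rceil> + ((\<Sum>i<Suc j. level_cost (tries \<delta> i) i) +
       trial_cost (nat \<lceil>400 * 2 ^ Suc j / \<epsilon>\<rceil>))))) \<le> soft_O_bound 120000 2 (L / \<epsilon> + log 2 (1 / \<delta>))"
proof -
  define l where "l = log 2 (1 / \<delta>)"
  define \<tau> where "\<tau> = max 2 (L / \<epsilon> + l)"
  define e where "e = log 2 \<tau>"
  \<comment> \<open>Minimality gives \<open>2 ^ j \<le> 4 * L\<close>; for \<open>j = 0\<close> this
    uses \<open>1 \<le> L\<close>.\<close>
  define j where "j = (LEAST j. 2 * L \<le> 2 ^ j)"
  define P :: real where "P = 2 ^ j"
  have l: "0 < l" using \<delta> by (simp add: l_def)
  have "\<exists>j. 2 * L \<le> 2 ^ j" using real_arch_pow[of 2 "2 * L"] by (auto intro: less_imp_le)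
  then have j1: "2 * L \<le> P" unfolding j_def P_def by (rule LeastI_ex)
  have j2: "P \<le> 4 * L"
  proof (cases j)
    case 0
    then show ?thesis using L by (simp add: P_def)
  next
    case (Suc i)
    have "\<not> 2 * L \<le> 2 ^ i" using not_less_Least[of i "\<lambda>j. 2 * L \<le> 2 ^ j"] Suc by (simp add: j_def)
    then show ?thesis using Suc by (simp add: P_def)
  qed
  have L\<epsilon>: "L \<le> L / \<epsilon>" "1 / \<epsilon> \<le> L / \<epsilon>" using \<epsilon> L by (simp_all add: field_simps mult_left_le)
  have \<tau>: "2 \<le> \<tau>" "L / \<epsilon> \<le> \<tau>" "l \<le> \<tau>" "L \<le> \<tau>" "1 / \<epsilon> \<le> \<tau>"
    using l L\<epsilon> L by (auto simp: \<tau>_def)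
  have e: "1 \<le> e" using \<tau>(1) by (simp add: e_def le_log_iff)
  have P: "1 \<le> P" "P \<le> 4 * \<tau>" "P / \<epsilon> \<le> 4 * \<tau>"
  proof -
    show "1 \<le> P" by (simp add: P_def)
    show "P \<le> 4 * \<tau>" using j2 \<tau>(4) by linarith
    have "P / \<epsilon> \<le> 4 * L / \<epsilon>" using j2 \<epsilon> by (intro divide_right_mono) auto
    then show "P / \<epsilon> \<le> 4 * \<tau>" using \<tau>(2) by simp
  qed
  have je: "real j \<le> 3 * e"
  proof -
    have "real j = log 2 P" by (simp add: P_def log_nat_power)
    also have "\<dots> \<le> log 2 (4 * \<tau>)" using P by simp
    also have "\<dots> = 2 + e" using \<tau>(1) log2_of_power_eq[of 4 2] by (simp add: e_def log_mult)
    finally show ?thesis using e by simp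
  qed
  have \<tau>e: "\<tau> \<le> \<tau> * e" "\<tau> * e \<le> \<tau> * e ^ 2"
    using \<tau>(1) e by (simp_all add: power2_eq_square)
  have lev: "level_cost (tries \<delta> i) i \<le> 108 * (\<tau> * e)" if "i < Suc j" for i
  proof -
    define p :: real where "p = 2 ^ i"
    have p: "1 \<le> p" "p \<le> P" using that by (auto simp: p_def P_def intro!: power_increasing)
    have "real (tries \<delta> i) \<le> 5 + 2 * l / p"
    proof -
      have "0 \<le> 4 + 2 * log 2 (1 / \<delta>) / 2 ^ i" using l by (simp add: l_def)
      then show ?thesis unfolding tries_def l_def p_def by linarith
    qed
    then have "p * tries \<delta> i \<le> p * (5 + 2 * l / p)" using p by (intro mult_left_mono) auto
    moreover have "p * (5 + 2 * l / p) = 5 * p + 2 * l" using p by (simp add: field_simps)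
    ultimately have pr: "p * tries \<delta> i \<le> 5 * p + 2 * l" by linarith
    have r: "tries \<delta> i + (real i + 5) \<le> p * (tries \<delta> i + (real i + 5))"
      using p by (simp add: mult_le_cancel_right1)
    have "real (level_cost (tries \<delta> i) i) = p * (tries \<delta> i + (real i + 1)) + (tries \<delta> i + (real i + 5))"
      by (simp add: level_cost_def p_def algebra_simps)
    also have "\<dots> \<le> 2 * (p * (tries \<delta> i + (real i + 5)))"
      using r p by (simp add: algebra_simps)
    also have "\<dots> = 2 * (p * tries \<delta> i) + 2 * (p * (real i + 5))" by (simp add: algebra_simps)
    also have "\<dots> \<le> 2 * (5 * P + 2 * l) + 2 * (P * (3 * e + 5))"
      using pr p je that by (intro add_mono mult_left_mono mult_mono) auto
    also have "\<dots> \<le> 2 * (5 * (4 * \<tau>) + 2 * \<tau>) + 2 * (4 * \<tau> * (3 * e + 5))"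
      using P \<tau> e by (intro add_mono mult_left_mono mult_right_mono) auto
    also have "\<dots> = 84 * \<tau> + 24 * (\<tau> * e)" by (simp add: algebra_simps)
    finally show ?thesis using \<tau>e by linarith
  qed
  have "real (\<Sum>i<Suc j. level_cost (tries \<delta> i) i) = (\<Sum>i<Suc j. real (level_cost (tries \<delta> i) i))"
    by (rule of_nat_sum)
  also have "\<dots> \<le> real (card {..<Suc j}) * (108 * (\<tau> * e))"
    using lev by (intro sum_bounded_above) auto
  \<comment> \<open>\<open>Suc j \<le> 3 * e + 1 \<le> 4 * e\<close>: the number of levels accounts
    for the second logarithmic factor.\<close>
  also have "\<dots> \<le> 4 * e * (108 * (\<tau> * e))"
    using je e \<tau> by (intro mult_right_mono) auto
  finally have levels: "real (\<Sum>i<Suc j. level_cost (tries \<delta> i) i) \<le> 432 * (\<tau> * e ^ 2)"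
    by (simp add: power2_eq_square mult_ac)
  define M where "M = nat \<lceil>400 * 2 ^ Suc j / \<epsilon>\<rceil>"
  have PM: "0 < 800 * P / \<epsilon>" using P \<epsilon> by simp
  \<comment> \<open>\<open>3201 = 800 * 4 + 1\<close>, with the 1 for the ceiling; it is at most
    \<open>2 ^ 12\<close>, which is used for the logarithm.\<close>
  have M: "0 < M" "real M \<le> 3201 * \<tau>"
  proof -
    have M_eq: "M = nat \<lceil>800 * P / \<epsilon>\<rceil>" by (simp add: M_def P_def)
    show "0 < M" using PM by (simp add: M_eq)
    have "real M \<le> 800 * (P / \<epsilon>) + 1" using PM unfolding M_eq by simp
    then show "real M \<le> 3201 * \<tau>" using P(3) \<tau>(1) by linarith
  qed
  have lnM: "ln (real M) \<le> 13 * e"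
  proof -
    have "ln (real M) \<le> log 2 (real M)" using M by (intro ln_le_log2) auto
    also have "\<dots> \<le> log 2 (2 ^ 12 * \<tau>)" using M \<tau> by simp
    also have "\<dots> = 12 + e" using \<tau>(1) by (simp add: e_def log_mult log_nat_power del: power_numeral)
    finally show ?thesis using e by simp
  qed
  have "real (trial_cost M) \<le> M * (9 + 2 * ln (real M))" by (rule trial_cost_le[OF M(1)])
  also have "\<dots> \<le> 3201 * \<tau> * (9 * e + 2 * (13 * e))"
    using M lnM e \<tau> by (intro mult_mono add_mono mult_left_mono) auto
  finally have trials: "real (trial_cost M) \<le> 112035 * (\<tau> * e)" by simp
  have s: "real (nat \<lceil>40 / \<epsilon>\<rceil>) \<le> 41 * \<tau>"
  proof -
    have "0 < 40 / \<epsilon>" using \<epsilon> by simp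
    then have "real (nat \<lceil>40 / \<epsilon>\<rceil>) \<le> 40 * (1 / \<epsilon>) + 1" by simp
    then show ?thesis using \<tau> by linarith
  qed
  have "real (Suc (6 + (nat \<lceil>40 / \<epsilon>\<rceil> + ((\<Sum>i<Suc j. level_cost (tries \<delta> i) i) + trial_cost M))))
      = 7 + real (nat \<lceil>40 / \<epsilon>\<rceil>) + real (\<Sum>i<Suc j. level_cost (tries \<delta> i) i) + real (trial_cost M)"
    by (simp only: of_nat_Suc of_nat_add)
  \<comment> \<open>The coefficients 41, 432 and 112035 and the constant 7 add up to less than
    120000.\<close>
  also have "\<dots> \<le> 120000 * (\<tau> * e ^ 2)"
    using levels trials s \<tau>e \<tau>(1) by linarith
  also have "\<dots> = soft_O_bound 120000 2 (L / \<epsilon> + log 2 (1 / \<delta>))"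
    by (simp add: soft_O_bound_def \<tau>_def e_def l_def)
  finally show thesis using that j1 unfolding P_def M_def by blast
qed

section \<open>Completeness, cost and soundness of the tester\<close>

lemma safe_unate_tester:
  assumes ne: "ones n f \<noteq> {}" and "unate n f"
  shows "safe n f (unate_tester \<epsilon> \<delta>)"
proof -
  have "safe n f (main \<epsilon> \<delta> z x)" for z x
    unfolding main_def using reach_safe[OF reach_certify ne] reach_safe[OF reach_trials ne] assms by simp
  then have far: "safe n f (farthest s z x (main \<epsilon> \<delta> z))" for s z x
    by (induction s arbitrary: x) (auto intro: safe_Sample[OF ne])
  have "safe n f (if_another_one r z (farthest s z z (main \<epsilon> \<delta> z)))" for r s z
    by (induction r) (auto simp: far intro: safe_Sample[OF ne])
  then show ?thesis unfolding unate_tester_def by (intro safe_Sample[OF ne])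
qed

lemma bad_unate_tester:
  assumes ne: "ones n f \<noteq> {}" and \<epsilon>: "0 < \<epsilon>" "\<epsilon> < 1" and \<delta>: "0 < \<delta>" "\<delta> < 1"
  obtains B where "bad n f (unate_tester \<epsilon> \<delta>) B \<le> \<delta>"
    "real B \<le> soft_O_bound 120000 2 (log 2 (card (ones n f)) / \<epsilon> + log 2 (1 / \<delta>))"
proof (cases "card (ones n f) = 1")
  case True
  then obtain w where w: "ones n f = {w}" by (auto simp: card_1_singleton_iff)
  \<comment> \<open>Every sample equals \<open>w\<close>, so the continuation \<open>k\<close> is
    never started.\<close>
  have pre: "bad n f (if_another_one r w k) r \<le> 0" for r k
    by (induction r) (auto simp: w intro!: bad_Sample_le[OF ne])
  then have "bad n f (unate_tester \<epsilon> \<delta>) (Suc 6) \<le> 0"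
    unfolding unate_tester_def by (intro bad_Sample_le[OF ne]) (simp only: w singleton_iff pre)
  moreover have "real (Suc 6) \<le> soft_O_bound 120000 2 (log 2 (card (ones n f)) / \<epsilon> + log 2 (1 / \<delta>))"
  proof -
    let ?\<tau> = "max 2 (log 2 (card (ones n f)) / \<epsilon> + log 2 (1 / \<delta>))"
    have "1 \<le> log 2 ?\<tau> ^ 2" by (intro one_le_power) (simp add: le_log_iff)
    then have "120000 * 2 * 1 \<le> 120000 * ?\<tau> * log 2 ?\<tau> ^ 2" by (intro mult_mono) auto
    then show ?thesis by (simp add: soft_O_bound_def)
  qed
  ultimately show thesis using \<delta> by (intro that[of "Suc 6"]) auto
next
  case False
  then have N: "2 \<le> card (ones n f)" using card_ones_pos[OF ne] by linarith
  then have "1 \<le> log 2 (card (ones n f))" by (simp add: le_log_iff)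
  then obtain j where j: "2 * log 2 (card (ones n f)) \<le> 2 ^ j"
    "real (Suc (6 + (nat \<lceil>40 / \<epsilon>\<rceil> + ((\<Sum>i<Suc j. level_cost (tries \<delta> i) i) +
       trial_cost (nat \<lceil>400 * 2 ^ Suc j / \<epsilon>\<rceil>)))))
     \<le> soft_O_bound 120000 2 (log 2 (card (ones n f)) / \<epsilon> + log 2 (1 / \<delta>))"
    by (rule cost_bound[OF _ \<epsilon> \<delta>])
  have "bad n f (unate_tester \<epsilon> \<delta>) (Suc (6 + (nat \<lceil>40 / \<epsilon>\<rceil> + ((\<Sum>i<Suc j. level_cost (tries \<delta> i) i) +
      trial_cost (nat \<lceil>400 * 2 ^ Suc j / \<epsilon>\<rceil>))))) \<le> \<delta>"
    unfolding unate_tester_def using \<delta>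
    by (intro bad_Sample_le[OF ne] bad_if_another_one[OF ne] bad_farthest[OF ne]
        bad_main[OF _ _ \<delta> \<epsilon>(1) j(1)]) auto
  then show thesis by (rule that[OF _ j(2)])
qed

lemma acc_unate_tester:
  assumes ne: "ones n f \<noteq> {}" and \<epsilon>: "0 < \<epsilon>" "\<epsilon> < 1" and far: "reldist_unate n f > \<epsilon>"
  shows "acc n f (unate_tester \<epsilon> \<delta>) \<le> 1 / 3"
proof -
  let ?N = "real (card (ones n f))"
  let ?s = "nat \<lceil>40 / \<epsilon>\<rceil>"
  have zn: "length z = n" if "z \<in> ones n f" for z using that by (simp add: ones_def cube_def)
  \<comment> \<open>A single one would form a \<open>far_instance\<close> of radius 0, against
    \<open>d_pos\<close>.\<close>
  have N: "2 \<le> card (ones n f)"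
  proof (rule ccontr)
    assume "\<not> 2 \<le> card (ones n f)"
    then have "card (ones n f) = 1" using card_ones_pos[OF ne] by linarith
    then obtain w where w: "ones n f = {w}" by (auto simp: card_1_singleton_iff)
    have "diff w w = []" by (simp add: diff_def)
    then have "{x \<in> ones n f. 0 < length (diff x w)} = {}" using w by auto
    then have "real (card {x \<in> ones n f. 0 < length (diff x w)}) = 0" by (metis card.empty of_nat_0)
    then have "real (card {x \<in> ones n f. 0 < length (diff x w)}) \<le> \<epsilon> / 10 * ?N" using \<epsilon> by simp
    moreover have "length w = n" using zn w by simp
    ultimately have "far_instance n f \<epsilon> w 0" using far_instance.intro[OF ne \<epsilon> far] by blast
    then show False using far_instance.d_pos by blast
  qed
  have "acc n f (farthest ?s z z (main \<epsilon> \<delta> z)) \<le> 1 / 5 + 1 / 25" if z: "z \<in> ones n f" for z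
  proof -
    \<comment> \<open>The second term is the risk that the farthest sample leaves too many outliers;
      with at least \<open>40 / \<epsilon>\<close> samples it is at most
      \<open>exp (- 4) \<le> 1 / 25\<close>.\<close>
    have "acc n f (farthest ?s z z (main \<epsilon> \<delta> z)) \<le> 1 / 5 + (1 - \<epsilon> / 10) ^ ?s"
    proof (rule acc_farthest[OF ne])
      fix x assume "x \<in> {x \<in> ones n f. card {y \<in> ones n f. length (diff x z) < length (diff y z)} \<le> \<epsilon> / 10 * ?N}"
      then show "acc n f (main \<epsilon> \<delta> z x) \<le> 1 / 5"
        by (intro acc_main, unfold_locales) (use ne \<epsilon> far zn[OF z] in auto)
    qed (use \<epsilon> z in auto)
    also have "(1 - \<epsilon> / 10) ^ ?s \<le> exp (- \<epsilon> / 10) ^ ?s"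
      using exp_ge_add_one_self[of "- \<epsilon> / 10"] \<epsilon> by (intro power_mono) auto
    also have "\<dots> = exp (- (?s * (\<epsilon> / 10)))"
      by (simp add: exp_of_nat_mult[symmetric])
    also have "\<dots> \<le> exp (- 4)"
    proof -
      have "40 / \<epsilon> * (\<epsilon> / 10) \<le> ?s * (\<epsilon> / 10)"
        using real_nat_ceiling_ge[of "40 / \<epsilon>"] \<epsilon> by (intro mult_right_mono) auto
      then show ?thesis using \<epsilon> by simp
    qed
    also have "exp (- 4) = 1 / (exp 2 * exp (2::real))"
      by (simp add: exp_minus exp_add[symmetric] inverse_eq_divide)
    also have "\<dots> \<le> 1 / (5 * 5)"
      using exp_ge_5 by (intro divide_left_mono mult_mono) auto
    finally show ?thesis by simp
  qed
  \<comment> \<open>The last term is the risk that six samples all repeat \<open>z\<close>; the sum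
    is below \<open>1 / 3\<close>.\<close>
  then have "acc n f (unate_tester \<epsilon> \<delta>) \<le> (1 / 5 + 1 / 25) + (1 / 2) ^ 6"
    unfolding unate_tester_def by (intro acc_Sample_le[OF ne] acc_if_another_one[OF ne N]) auto
  then show ?thesis by (simp add: power_divide)
qed

theorem theorem6p1:
  shows "\<exists>(A :: nat \<Rightarrow> real \<Rightarrow> real \<Rightarrow> tester) (C :: real) (k :: nat).
    \<forall>(n :: nat) (f :: bool list \<Rightarrow> bool) (\<epsilon> :: real) (\<delta> :: real).
      ones n f \<noteq> {} \<longrightarrow> 0 < \<epsilon> \<longrightarrow> \<epsilon> < 1 \<longrightarrow> 0 < \<delta> \<longrightarrow> \<delta> < 1 \<longrightarrow>
      (let N = card (ones n f); R = run n f (A n \<epsilon> \<delta>) in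
         measure_pmf.prob R
           {(b, q). real q \<le> soft_O_bound C k (log 2 (real N) / \<epsilon> + log 2 (1 / \<delta>))} \<ge> 1 - \<delta> \<and>
         (unate n f \<longrightarrow> measure_pmf.prob R {(b, q). b} = 1) \<and>
         (reldist_unate n f > \<epsilon> \<longrightarrow> measure_pmf.prob R {(b, q). \<not> b} \<ge> 2 / 3))"
proof (rule exI[of _ "\<lambda>n. unate_tester"], rule exI[of _ 120000], rule exI[of _ 2], intro allI impI)
  fix n :: nat and f :: "bool list \<Rightarrow> bool" and \<epsilon> \<delta> :: real
  assume ne: "ones n f \<noteq> {}" and \<epsilon>: "0 < \<epsilon>" "\<epsilon> < 1" and \<delta>: "0 < \<delta>" "\<delta> < 1"
  let ?T = "unate_tester \<epsilon> \<delta>" and ?N = "card (ones n f)"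
  let ?S = "soft_O_bound 120000 2 (log 2 (real ?N) / \<epsilon> + log 2 (1 / \<delta>))"
  obtain B where B: "bad n f ?T B \<le> \<delta>" "real B \<le> ?S"
    by (rule bad_unate_tester[OF ne \<epsilon> \<delta>])
  have "1 - bad n f ?T B = pr n f ?T (- {r. B < snd r})"
    unfolding bad_def using measure_pmf.prob_compl[of "{r. B < snd r}" "run n f ?T"]
    by (simp add: Compl_eq_Diff_UNIV)
  also have "\<dots> \<le> pr n f ?T {(b, q). real q \<le> ?S}"
    using B(2) by (intro measure_pmf.finite_measure_mono) auto
  finally have cost: "1 - \<delta> \<le> pr n f ?T {(b, q). real q \<le> ?S}" using B(1) by linarith
  have complete: "pr n f ?T {(b, q). b} = 1" if "unate n f"
    using safe_unate_tester[OF ne that, of \<epsilon> \<delta>]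
    by (subst measure_pmf.prob_eq_1) (auto simp: AE_measure_pmf_iff safe_def)
  have "pr n f ?T {(b, q). \<not> b} = 1 - acc n f ?T"
  proof -
    have "{(b :: bool, q :: nat). \<not> b} = - {r. fst r}" by auto
    then show ?thesis
      unfolding acc_def using measure_pmf.prob_compl[of "{r. fst r}" "run n f ?T"]
      by (simp add: Compl_eq_Diff_UNIV)
  qed
  then have sound: "2 / 3 \<le> pr n f ?T {(b, q). \<not> b}" if "reldist_unate n f > \<epsilon>"
    using acc_unate_tester[OF ne \<epsilon> that, of \<delta>] by linarith
  show "let N = card (ones n f); R = run n f (unate_tester \<epsilon> \<delta>) in
         measure_pmf.prob R
           {(b, q). real q \<le> soft_O_bound 120000 2 (log 2 (real N) / \<epsilon> + log 2 (1 / \<delta>))} \<ge> 1 - \<delta> \<and>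
         (unate n f \<longrightarrow> measure_pmf.prob R {(b, q). b} = 1) \<and>
         (reldist_unate n f > \<epsilon> \<longrightarrow> measure_pmf.prob R {(b, q). \<not> b} \<ge> 2 / 3)"
    unfolding Let_def using cost complete sound by blast
qed

end
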